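(* Suppose $E:\mathcal{P}_{2,\omega_0}(\mathbb{R}^d)\to\mathbb{R}\cup\{+\infty\}$ is proper, coercive, lower semicontinuous and $\lambda$-convex along generalized geodesics for some $\lambda\in\mathbb{R}$. Then for $\mu\in D(|\partial E|)$, $0<h\le\tau<\frac1{\lambda^-}$ and integers $n,m\ge0$, $$W_2^2(J^n_\tau\mu,J^m_h\mu)\le\big[(n\tau-mh)^2+\tau hm+2\tau^2n\big](1-\lambda^-\tau)^{-2n}(1-\lambda^-h)^{-2m}|\partial E|^2(\mu).$$
   Context: Fix a probability measure $\omega_0$ on $\mathbb{R}^d$. $W_2$ is the quadratic Wasserstein distance, $\Gamma_0(\mu,\nu)$ the optimal couplings; $\mathcal{P}_{2,\omega_0}(\mathbb{R}^d)=\{\mu:W_2(\mu,\omega_0)<\infty\}$. A transport plan from $\mu_0$ to $\mu_1$ with base $\omega$ is $\boldsymbol\omega\in\mathcal{P}((\mathbb{R}^d)^3)$ with $\pi^{1,2}\#\boldsymbol\omega\in\Gamma_0(\omega,\mu_0)$, $\pi^{1,3}\#\boldsymbol\omega\in\Gamma_0(\omega,\mu_1)$; generalized geodesic $\mu_\alpha=((1-\alpha)\pi^2+\alpha\pi^3)\#\boldsymbol\omega$; $W_{2,\boldsymbol\omega}(\mu_0,\mu_1)=(\int|x_2-x_3|^2d\boldsymbol\omega)^{1/2}$. $D(E)=\{E<\infty\}$; proper: $D(E)\ne\emptyset$; coercive: $\exists\tau_0>0,u_0$ with $\inf_v\{\frac1{2\tau_0}W_2^2(u_0,v)+E(v)\}>-\infty$;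 lower semicontinuous w.r.t. $W_2$; $\lambda$-convex along generalized geodesics: for all $\mu_0,\mu_1,\omega$ there is a generalized geodesic from $\mu_0$ to $\mu_1$ with base $\omega$ (induced by some $\boldsymbol\omega$) with $E(\mu_\alpha)\le(1-\alpha)E(\mu_0)+\alpha E(\mu_1)-\alpha(1-\alpha)\frac\lambda2W^2_{2,\boldsymbol\omega}(\mu_0,\mu_1)$. $\lambda^-=\max\{0,-\lambda\}$, $1/\lambda^-=+\infty$ if $\lambda^-=0$. $J_\tau\mu=\operatorname{argmin}_\nu\{\frac1{2\tau}W_2^2(\mu,\nu)+E(\nu)\}$, $J^n_\tau$ its $n$-fold iterate, $J^0_\tau\mu=\mu$. Metric slope $|\partial E|(\mu)=\limsup_{\nu\to\mu}(E(\mu)-E(\nu))^+/W_2(\mu,\nu)$; $D(|\partial E|)=\{\mu\in D(E):|\partial E|(\mu)<\infty\}$. *)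

theory Defs
  imports "HOL-Probability.Probability"
begin

definition prob_meas :: "'a::euclidean_space measure set" where
  "prob_meas = {M. prob_space M \<and> sets M = sets borel}"

definition couplings :: "'a::euclidean_space measure \<Rightarrow> 'a measure \<Rightarrow> ('a \<times> 'a) measure set" where
  "couplings \<mu> \<nu> = {\<pi>. prob_space \<pi> \<and> sets \<pi> = sets borel \<and>
      distr \<pi> borel fst = \<mu> \<and> distr \<pi> borel snd = \<nu>}"

definition tcost :: "('a::euclidean_space \<times> 'a) measure \<Rightarrow> ennreal" where
  "tcost \<pi> = (\<integral>\<^sup>+ p. ennreal ((dist (fst p) (snd p))^2) \<partial>\<pi>)"

definition W2sq :: "'a::euclidean_space measure \<Rightarrow> 'a measure \<Rightarrow> ennreal" where
  "W2sq \<mu> \<nu> = (INF \<pi> \<in> couplings \<mu> \<nu>. tcost \<pi>)"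

text \<open>Real-valued W2, used only between measures at finite distance.\<close>
definition W2 :: "'a::euclidean_space measure \<Rightarrow> 'a measure \<Rightarrow> real" where
  "W2 \<mu> \<nu> = sqrt (enn2real (W2sq \<mu> \<nu>))"

definition opt_couplings :: "'a::euclidean_space measure \<Rightarrow> 'a measure \<Rightarrow> ('a \<times> 'a) measure set" where
  "opt_couplings \<mu> \<nu> = {\<pi> \<in> couplings \<mu> \<nu>. tcost \<pi> = W2sq \<mu> \<nu>}"

definition P2 :: "'a::euclidean_space measure \<Rightarrow> 'a measure set" where
  "P2 \<omega>0 = {\<mu> \<in> prob_meas. W2sq \<mu> \<omega>0 < \<infinity>}"

definition transport_plans :: "'a::euclidean_space measure \<Rightarrow> 'a measure \<Rightarrow> 'a measure
    \<Rightarrow> ('a \<times> 'a \<times> 'a) measure set" where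
  "transport_plans \<omega> \<mu>0 \<mu>1 = {\<Omega>. prob_space \<Omega> \<and> sets \<Omega> = sets borel \<and>
      distr \<Omega> borel (\<lambda>(x,y,z). (x,y)) \<in> opt_couplings \<omega> \<mu>0 \<and>
      distr \<Omega> borel (\<lambda>(x,y,z). (x,z)) \<in> opt_couplings \<omega> \<mu>1}"

definition gen_geod :: "('a::euclidean_space \<times> 'a \<times> 'a) measure \<Rightarrow> real \<Rightarrow> 'a measure" where
  "gen_geod \<Omega> \<alpha> = distr \<Omega> borel (\<lambda>(x,y,z). (1 - \<alpha>) *\<^sub>R y + \<alpha> *\<^sub>R z)"

definition W2_plan_sq :: "('a::euclidean_space \<times> 'a \<times> 'a) measure \<Rightarrow> ennreal" where
  "W2_plan_sq \<Omega> = (\<integral>\<^sup>+ p. ennreal ((dist (fst (snd p)) (snd (snd p)))^2) \<partial>\<Omega>)"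

definition proper_on :: "'a::euclidean_space measure \<Rightarrow> ('a measure \<Rightarrow> ereal) \<Rightarrow> bool" where
  "proper_on \<omega>0 E \<longleftrightarrow> (\<exists>\<mu>\<in>P2 \<omega>0. E \<mu> < \<infinity>)"

definition coercive_on :: "'a::euclidean_space measure \<Rightarrow> ('a measure \<Rightarrow> ereal) \<Rightarrow> bool" where
  "coercive_on \<omega>0 E \<longleftrightarrow> (\<exists>\<tau>0>0. \<exists>u0\<in>P2 \<omega>0.
      (INF v\<in>P2 \<omega>0. ereal ((W2 u0 v)^2 / (2*\<tau>0)) + E v) > -\<infinity>)"

definition lsc_on :: "'a::euclidean_space measure \<Rightarrow> ('a measure \<Rightarrow> ereal) \<Rightarrow> bool" where
  "lsc_on \<omega>0 E \<longleftrightarrow> (\<forall>\<mu>\<in>P2 \<omega>0. \<forall>s. (\<forall>k. s k \<in> P2 \<omega>0) \<and> (\<lambda>k. W2 (s k) \<mu>) \<longlonglongrightarrow> 0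
      \<longrightarrow> E \<mu> \<le> liminf (\<lambda>k. E (s k)))"

definition gg_convex :: "'a::euclidean_space measure \<Rightarrow> real \<Rightarrow> ('a measure \<Rightarrow> ereal) \<Rightarrow> bool" where
  "gg_convex \<omega>0 lam E \<longleftrightarrow> (\<forall>\<mu>0\<in>P2 \<omega>0. \<forall>\<mu>1\<in>P2 \<omega>0. \<forall>\<omega>\<in>P2 \<omega>0.
     \<exists>\<Omega>\<in>transport_plans \<omega> \<mu>0 \<mu>1. \<forall>\<alpha>\<in>{0..1}.
       E (gen_geod \<Omega> \<alpha>) \<le> ereal (1 - \<alpha>) * E \<mu>0 + ereal \<alpha> * E \<mu>1
          - ereal (\<alpha> * (1 - \<alpha>) * lam / 2) * enn2ereal (W2_plan_sq \<Omega>))"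

text \<open>Minimizing movement step J_tau (the minimizer is unique under the hypotheses).\<close>
definition JKO :: "'a::euclidean_space measure \<Rightarrow> ('a measure \<Rightarrow> ereal) \<Rightarrow> real \<Rightarrow> 'a measure \<Rightarrow> 'a measure" where
  "JKO \<omega>0 E \<tau> \<mu> = (SOME \<nu>. \<nu> \<in> P2 \<omega>0 \<and> (\<forall>v\<in>P2 \<omega>0.
      ereal ((W2 \<mu> \<nu>)^2 / (2*\<tau>)) + E \<nu> \<le> ereal ((W2 \<mu> v)^2 / (2*\<tau>)) + E v))"

definition slope :: "'a::euclidean_space measure \<Rightarrow> ('a measure \<Rightarrow> ereal) \<Rightarrow> 'a measure \<Rightarrow> ereal" where
  "slope \<omega>0 E \<mu> = (INF r\<in>{0::real<..}. SUP \<nu>\<in>{\<nu>\<in>P2 \<omega>0. 0 < W2 \<mu> \<nu> \<and> W2 \<mu> \<nu> < r}.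
      max 0 ((E \<mu> - E \<nu>) / ereal (W2 \<mu> \<nu>)))"

end

theory Submission
  imports Defs
begin

text \<open>
  Everything rests on the discrete evolution variational inequality of one minimizing step
  \<open>y = J\<^sub>\<tau> x\<close>,
  \<open>d(x,y)\<^sup>2 + (1 - l\<tau>) d(y,v)\<^sup>2 - d(x,v)\<^sup>2 \<le> 2\<tau> (E v - E y)\<close> with \<open>l = \<lambda>\<^sup>-\<close>,
  which follows from convexity along generalized geodesics based at \<open>x\<close>. Testing the inequality of each of
  the two schemes with the current iterate of the other one cancels the energies, and
  \<open>D n m = d(J\<^sub>\<tau>\<^sup>n \<mu>, J\<^sub>h\<^sup>m \<mu>)\<^sup>2\<close> satisfies
  \<open>(h (1 - l\<tau>) + \<tau> (1 - lh)) D n m \<le> h D (n-1) m + \<tau> D n (m-1)\<close>.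
  As in Kobayashi's proof of the Crandall-Liggett theorem, induction then yields the bound even with
  \<open>n \<tau>\<^sup>2 + m h\<^sup>2\<close> in place of \<open>\<tau> h m + 2 \<tau>\<^sup>2 n\<close>; the metric slope enters only in the cases \<open>n = 0\<close> and \<open>m = 0\<close>.

  Minimizers exist because minimizing sequences are Cauchy and \<open>W2\<close> is complete. Completeness needs
  Prokhorov's theorem in Euclidean space, which is reduced to Helly's selection theorem on the line:
  a continuous space-filling curve with a measurable, locally bounded section transports tight
  sequences to the line and their limits back.
\<close>

section \<open>Minimizing movements under convexity along generalized geodesics\<close>

text \<open>The obstacle is that the squared Wasserstein distance to a fixed measure is in general
  not convex along Wasserstein geodesics, so convexity of \<open>E\<close> along those would not
  control the functional minimized in one step. Along a generalized geodesic based at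
  \<open>w\<close> the squared distance to \<open>w\<close> is convex with modulus the plan cost
  \<open>K\<close>, and the convexity defect of \<open>E\<close> is measured by the same
  \<open>K\<close>, which may exceed \<open>(d x y)\<^sup>2\<close>. The two contributions therefore
  have to be added before \<open>K\<close> is compared with the distance: together they give
  \<open>(1 / \<tau> - l) / 2\<close> times \<open>K\<close>, which is positive by the restriction
  on the step, and only then may \<open>K\<close> be replaced by the smaller
  \<open>(d x y)\<^sup>2\<close>. This is the origin of the factors \<open>1 - l * \<tau>\<close>.
  For the same reason \<open>E_convex\<close> provides one \<open>K\<close> for both inequalities.
  Positivity of the distance between distinct points is not among the axioms.\<close>

locale gg_convex_space =
  fixes X :: "'b set" and d :: "'b \<Rightarrow> 'b \<Rightarrow> real" and E :: "'b \<Rightarrow> ereal" and l :: real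
  assumes d_nonneg: "0 \<le> d x y"
    and d_refl: "x \<in> X \<Longrightarrow> d x x = 0"
    and d_sym: "x \<in> X \<Longrightarrow> y \<in> X \<Longrightarrow> d x y = d y x"
    and d_triangle: "x \<in> X \<Longrightarrow> y \<in> X \<Longrightarrow> z \<in> X \<Longrightarrow> d x z \<le> d x y + d y z"
    and d_complete: "(\<And>k. s k \<in> X) \<Longrightarrow> (\<And>e. 0 < e \<Longrightarrow> \<exists>N. \<forall>i\<ge>N. \<forall>j\<ge>N. d (s i) (s j) < e)
      \<Longrightarrow> \<exists>x\<in>X. (\<lambda>k. d (s k) x) \<longlonglongrightarrow> 0"
    and l_nonneg: "0 \<le> l"
    and E_not_MInf: "x \<in> X \<Longrightarrow> E x \<noteq> -\<infinity>"
    and E_lsc: "x \<in> X \<Longrightarrow> (\<And>k. s k \<in> X) \<Longrightarrow> (\<lambda>k. d (s k) x) \<longlonglongrightarrow> 0 \<Longrightarrow> E x \<le> liminf (\<lambda>k. E (s k))"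
    and E_coercive: "\<exists>T>0. \<exists>u\<in>X. \<exists>A::real. \<forall>v\<in>X. ereal A \<le> ereal ((d u v)\<^sup>2 / (2*T)) + E v"
    and E_convex: "w \<in> X \<Longrightarrow> x \<in> X \<Longrightarrow> y \<in> X \<Longrightarrow> \<exists>\<gamma> K. (d x y)\<^sup>2 \<le> K \<and> (\<forall>\<alpha>\<in>{0..1}. \<gamma> \<alpha> \<in> X
        \<and> (d w (\<gamma> \<alpha>))\<^sup>2 \<le> (1 - \<alpha>) * (d w x)\<^sup>2 + \<alpha> * (d w y)\<^sup>2 - \<alpha> * (1 - \<alpha>) * K
        \<and> E (\<gamma> \<alpha>) \<le> ereal (1 - \<alpha>) * E x + ereal \<alpha> * E y + ereal (\<alpha> * (1 - \<alpha>) * l / 2 * K))"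
begin

section \<open>Finite energies and the discrete evolution variational inequality\<close>

definition dom_E :: "'b set" where "dom_E = {x \<in> X. E x < \<infinity>}"

text \<open>Meaningful on \<open>dom_E\<close> only, since \<open>real_of_ereal\<close> sends
  infinity to 0.\<close>

definition e :: "'b \<Rightarrow> real" where "e x = real_of_ereal (E x)"

text \<open>A relation, so that the estimates hold for any choice of minimizers, in particular for
  the one made by \<open>JKO\<close>.\<close>

definition is_step :: "real \<Rightarrow> 'b \<Rightarrow> 'b \<Rightarrow> bool" where
  "is_step \<tau> x y \<longleftrightarrow> y \<in> X \<and>
     (\<forall>v\<in>X. ereal ((d x y)\<^sup>2 / (2*\<tau>)) + E y \<le> ereal ((d x v)\<^sup>2 / (2*\<tau>)) + E v)"

lemma dom_subset: "x \<in> dom_E \<Longrightarrow> x \<in> X"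
  by (simp add: dom_E_def)

lemma E_dom: "x \<in> dom_E \<Longrightarrow> E x = ereal (e x)"
  using E_not_MInf[of x] by (cases "E x") (auto simp: dom_E_def e_def)

lemma in_domI: "x \<in> X \<Longrightarrow> E x \<le> ereal a \<Longrightarrow> x \<in> dom_E"
  by (cases "E x") (auto simp: dom_E_def)

lemma e_convex:
  assumes "w \<in> X" "x \<in> dom_E" "y \<in> dom_E"
  obtains \<gamma> K where "(d x y)\<^sup>2 \<le> K"
    and "\<And>\<alpha>. 0 \<le> \<alpha> \<Longrightarrow> \<alpha> \<le> 1 \<Longrightarrow> \<gamma> \<alpha> \<in> dom_E"
    and "\<And>\<alpha>. 0 \<le> \<alpha> \<Longrightarrow> \<alpha> \<le> 1 \<Longrightarrow>
        (d w (\<gamma> \<alpha>))\<^sup>2 \<le> (1 - \<alpha>) * (d w x)\<^sup>2 + \<alpha> * (d w y)\<^sup>2 - \<alpha> * (1 - \<alpha>) * K"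
    and "\<And>\<alpha>. 0 \<le> \<alpha> \<Longrightarrow> \<alpha> \<le> 1 \<Longrightarrow>
        e (\<gamma> \<alpha>) \<le> (1 - \<alpha>) * e x + \<alpha> * e y + \<alpha> * (1 - \<alpha>) * l / 2 * K"
proof -
  obtain \<gamma> K where g: "(d x y)\<^sup>2 \<le> K" "\<forall>\<alpha>\<in>{0..1}. \<gamma> \<alpha> \<in> X
        \<and> (d w (\<gamma> \<alpha>))\<^sup>2 \<le> (1 - \<alpha>) * (d w x)\<^sup>2 + \<alpha> * (d w y)\<^sup>2 - \<alpha> * (1 - \<alpha>) * K
        \<and> E (\<gamma> \<alpha>) \<le> ereal (1 - \<alpha>) * E x + ereal \<alpha> * E y + ereal (\<alpha> * (1 - \<alpha>) * l / 2 * K)"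
    using E_convex[of w x y] assms dom_subset by blast
  have b: "E (\<gamma> \<alpha>) \<le> ereal ((1 - \<alpha>) * e x + \<alpha> * e y + \<alpha> * (1 - \<alpha>) * l / 2 * K)"
    if "0 \<le> \<alpha>" "\<alpha> \<le> 1" for \<alpha>
    using g(2) that assms(2,3) by (auto simp: E_dom)
  have c: "\<gamma> \<alpha> \<in> dom_E" if "0 \<le> \<alpha>" "\<alpha> \<le> 1" for \<alpha>
    using g(2) that by (intro in_domI[OF _ b[OF that]]) auto
  show thesis
  proof (rule that[OF g(1) c])
    show "e (\<gamma> \<alpha>) \<le> (1 - \<alpha>) * e x + \<alpha> * e y + \<alpha> * (1 - \<alpha>) * l / 2 * K"
      if "0 \<le> \<alpha>" "\<alpha> \<le> 1" for \<alpha>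
      using b[OF that] E_dom[OF c[OF that]] by simp
  qed (use g(2) in auto)
qed

lemma e_lsc:
  assumes "x \<in> X" "\<And>k. s k \<in> dom_E" "(\<lambda>k. d (s k) x) \<longlonglongrightarrow> 0" "eventually (\<lambda>k. e (s k) \<le> a) sequentially"
  shows "E x \<le> ereal a"
proof -
  have "E x \<le> liminf (\<lambda>k. E (s k))"
    using assms dom_subset by (intro E_lsc) auto
  also have "\<dots> \<le> liminf (\<lambda>k. ereal a)"
    by (rule Liminf_mono) (use assms(2,4) in \<open>auto elim!: eventually_mono simp: E_dom\<close>)
  finally show ?thesis by (simp add: Liminf_const)
qed

text \<open>Points at distance 0 may differ, and the metric slope does not see them. The constant
  sequence at \<open>y\<close> converges to \<open>x\<close>, so lower semicontinuity compares the
  energies.\<close>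

lemma e_le_of_d_eq_0:
  assumes "x \<in> X" "y \<in> dom_E" "d x y = 0"
  shows "E x \<le> ereal (e y)"
  using assms d_sym[of x y] dom_subset by (intro e_lsc[where s = "\<lambda>_. y"]) auto

lemma is_step_dom:
  assumes "x \<in> dom_E" "is_step \<tau> x y"
  shows "y \<in> dom_E"
proof -
  have "ereal ((d x y)\<^sup>2 / (2*\<tau>)) + E y \<le> ereal ((d x x)\<^sup>2 / (2*\<tau>)) + E x" "y \<in> X"
    using assms dom_subset by (auto simp: is_step_def)
  then show ?thesis
    using assms(1) E_dom[of x] by (cases "E y") (auto simp: dom_E_def)
qed

lemma step_evi:
  assumes x: "x \<in> dom_E" and v: "v \<in> dom_E" and t: "0 < \<tau>" "l * \<tau> < 1" and step: "is_step \<tau> x y"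
  shows "(d x y)\<^sup>2 + (1 - l * \<tau>) * (d y v)\<^sup>2 - (d x v)\<^sup>2 \<le> 2 * \<tau> * (e v - e y)"
proof -
  have y: "y \<in> dom_E" using is_step_dom[OF x step] .
  obtain \<gamma> K where g: "(d y v)\<^sup>2 \<le> K"
    "\<And>\<alpha>. 0 \<le> \<alpha> \<Longrightarrow> \<alpha> \<le> 1 \<Longrightarrow> \<gamma> \<alpha> \<in> dom_E"
    "\<And>\<alpha>. 0 \<le> \<alpha> \<Longrightarrow> \<alpha> \<le> 1 \<Longrightarrow>
        (d x (\<gamma> \<alpha>))\<^sup>2 \<le> (1 - \<alpha>) * (d x y)\<^sup>2 + \<alpha> * (d x v)\<^sup>2 - \<alpha> * (1 - \<alpha>) * K"
    "\<And>\<alpha>. 0 \<le> \<alpha> \<Longrightarrow> \<alpha> \<le> 1 \<Longrightarrow>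
        e (\<gamma> \<alpha>) \<le> (1 - \<alpha>) * e y + \<alpha> * e v + \<alpha> * (1 - \<alpha>) * l / 2 * K"
    by (rule e_convex[OF dom_subset[OF x] y v]) (rule that)
  define R where "R = (d x v)\<^sup>2 + 2 * \<tau> * e v - (d x y)\<^sup>2 - 2 * \<tau> * e y"
  \<comment> \<open>Minimality of \<open>y\<close> against \<open>\<gamma> \<alpha>\<close>,
    multiplied by \<open>2 * \<tau>\<close> and divided by \<open>\<alpha>\<close>; the remaining
    factor \<open>1 - \<alpha>\<close> disappears in the limit at 0.\<close>
  have main: "(1 - \<alpha>) * ((1 - l * \<tau>) * K) \<le> R" if a: "0 < \<alpha>" "\<alpha> < 1" for \<alpha>
  proof -
    have "ereal ((d x y)\<^sup>2 / (2*\<tau>)) + E y \<le> ereal ((d x (\<gamma> \<alpha>))\<^sup>2 / (2*\<tau>)) + E (\<gamma> \<alpha>)"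
      using step a g(2)[of \<alpha>] dom_subset by (auto simp: is_step_def)
    then have "(d x y)\<^sup>2 / (2*\<tau>) + e y \<le> (d x (\<gamma> \<alpha>))\<^sup>2 / (2*\<tau>) + e (\<gamma> \<alpha>)"
      using y g(2)[of \<alpha>] a by (simp add: E_dom)
    then have "2 * \<tau> * ((d x y)\<^sup>2 / (2*\<tau>) + e y) \<le> 2 * \<tau> * ((d x (\<gamma> \<alpha>))\<^sup>2 / (2*\<tau>) + e (\<gamma> \<alpha>))"
      using t by (intro mult_left_mono) auto
    then have "(d x y)\<^sup>2 + 2 * \<tau> * e y \<le> (d x (\<gamma> \<alpha>))\<^sup>2 + 2 * \<tau> * e (\<gamma> \<alpha>)"
      using t by (simp add: distrib_left)
    also have "\<dots> \<le> ((1 - \<alpha>) * (d x y)\<^sup>2 + \<alpha> * (d x v)\<^sup>2 - \<alpha> * (1 - \<alpha>) * K)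
        + 2 * \<tau> * ((1 - \<alpha>) * e y + \<alpha> * e v + \<alpha> * (1 - \<alpha>) * l / 2 * K)"
      using g(3,4)[of \<alpha>] a t by (intro add_mono mult_left_mono) auto
    finally have "\<alpha> * ((1 - \<alpha>) * ((1 - l * \<tau>) * K)) \<le> \<alpha> * R"
      by (simp add: R_def algebra_simps diff_divide_distrib)
    then show ?thesis using a by simp
  qed
  have "((\<lambda>\<alpha>. (1 - \<alpha>) * ((1 - l * \<tau>) * K)) \<longlongrightarrow> (1 - 0) * ((1 - l * \<tau>) * K)) (at_right 0)"
    by (intro tendsto_intros)
  moreover have "eventually (\<lambda>\<alpha>. (1 - \<alpha>) * ((1 - l * \<tau>) * K) \<le> R) (at_right (0::real))"
    unfolding eventually_at_right_field using main by (intro exI[of _ 1]) auto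
  ultimately have "(1 - l * \<tau>) * K \<le> R"
    by (intro tendsto_upperbound[where F = "at_right (0::real)"]) auto
  moreover have "(1 - l * \<tau>) * (d y v)\<^sup>2 \<le> (1 - l * \<tau>) * K"
    using g(1) t by (intro mult_left_mono) auto
  ultimately show ?thesis by (simp add: R_def algebra_simps)
qed

section \<open>Lower bound of the energy and existence of minimizers\<close>

lemma e_convex_geodesic:
  assumes x: "x \<in> dom_E" and v: "v \<in> dom_E"
  obtains \<gamma> where "\<And>\<alpha>. 0 \<le> \<alpha> \<Longrightarrow> \<alpha> \<le> 1 \<Longrightarrow> \<gamma> \<alpha> \<in> dom_E"
    and "\<And>\<alpha>. 0 \<le> \<alpha> \<Longrightarrow> \<alpha> \<le> 1 \<Longrightarrow> d x (\<gamma> \<alpha>) \<le> \<alpha> * d x v"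
    and "\<And>\<alpha>. 0 \<le> \<alpha> \<Longrightarrow> \<alpha> \<le> 1 \<Longrightarrow>
        e (\<gamma> \<alpha>) \<le> (1 - \<alpha>) * e x + \<alpha> * e v + \<alpha> * (1 - \<alpha>) * l / 2 * (d x v)\<^sup>2"
proof -
  have xX: "x \<in> X" using x dom_subset by blast
  obtain \<gamma> K where g: "(d x v)\<^sup>2 \<le> K"
    "\<And>\<alpha>. 0 \<le> \<alpha> \<Longrightarrow> \<alpha> \<le> 1 \<Longrightarrow> \<gamma> \<alpha> \<in> dom_E"
    "\<And>\<alpha>. 0 \<le> \<alpha> \<Longrightarrow> \<alpha> \<le> 1 \<Longrightarrow>
        (d x (\<gamma> \<alpha>))\<^sup>2 \<le> (1 - \<alpha>) * (d x x)\<^sup>2 + \<alpha> * (d x v)\<^sup>2 - \<alpha> * (1 - \<alpha>) * K"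
    "\<And>\<alpha>. 0 \<le> \<alpha> \<Longrightarrow> \<alpha> \<le> 1 \<Longrightarrow>
        e (\<gamma> \<alpha>) \<le> (1 - \<alpha>) * e x + \<alpha> * e v + \<alpha> * (1 - \<alpha>) * l / 2 * K"
    by (rule e_convex[OF xX x v]) (rule that)
  \<comment> \<open>With the base at the start of the curve, nonnegativity of
    \<open>(d x (\<gamma> \<alpha>))\<^sup>2\<close> bounds \<open>K\<close> from above. As \<alpha>
    tends to 0 this forces \<open>K = (d x v)\<^sup>2\<close>, and the curve behaves like a geodesic
    issued from \<open>x\<close>.\<close>
  have "(1 - \<alpha>) * K \<le> (d x v)\<^sup>2" if a: "0 < \<alpha>" "\<alpha> < 1" for \<alpha>
  proof -
    have "0 \<le> \<alpha> * (d x v)\<^sup>2 - \<alpha> * (1 - \<alpha>) * K"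
      using order_trans[OF zero_le_power2 g(3)[of \<alpha>]] a by (simp add: d_refl[OF xX])
    then have "\<alpha> * ((1 - \<alpha>) * K) \<le> \<alpha> * (d x v)\<^sup>2" by (simp add: algebra_simps)
    then show ?thesis using a by simp
  qed
  then have "eventually (\<lambda>\<alpha>. (1 - \<alpha>) * K \<le> (d x v)\<^sup>2) (at_right (0::real))"
    unfolding eventually_at_right_field by (intro exI[of _ 1]) auto
  moreover have "((\<lambda>\<alpha>. (1 - \<alpha>) * K) \<longlongrightarrow> (1 - 0) * K) (at_right 0)"
    by (intro tendsto_intros)
  ultimately have "K \<le> (d x v)\<^sup>2"
    using tendsto_upperbound[where F = "at_right (0::real)"] by fastforce
  with g(1) have K: "K = (d x v)\<^sup>2" by simp
  show thesis
  proof (rule that[OF g(2)])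
    show "d x (\<gamma> \<alpha>) \<le> \<alpha> * d x v" if "0 \<le> \<alpha>" "\<alpha> \<le> 1" for \<alpha>
    proof (rule power2_le_imp_le)
      show "(d x (\<gamma> \<alpha>))\<^sup>2 \<le> (\<alpha> * d x v)\<^sup>2"
        using g(3)[OF that] by (simp add: K d_refl[OF xX] power2_eq_square algebra_simps)
    qed (use that d_nonneg in auto)
  qed (use g(4) K in auto)
qed

text \<open>Coercivity holds for a single, possibly small, time step; moving a far away point back to the
  unit ball along a geodesic shows that the energy decays at most like \<open>-l/2 d\<^sup>2\<close>.\<close>

lemma e_lower_bound:
  assumes x: "x \<in> dom_E"
  obtains C where "0 \<le> C" "\<And>v. v \<in> dom_E \<Longrightarrow> - C * (1 + d x v) - l / 2 * (d x v)\<^sup>2 \<le> e v"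
proof -
  obtain T u A where T: "T > 0" "u \<in> X" "\<And>v. v \<in> X \<Longrightarrow> ereal A \<le> ereal ((d u v)\<^sup>2 / (2*T)) + E v"
    using E_coercive by blast
  have xX: "x \<in> X" using x dom_subset by blast
  \<comment> \<open>In the unit ball around \<open>x\<close> one has
    \<open>d u v \<le> d u x + 1\<close>, so coercivity at the single step \<open>T\<close> bounds
    the energy there.\<close>
  define C0 where "C0 = \<bar>A\<bar> + (d u x + 1)\<^sup>2 / (2*T)"
  have C0: "0 \<le> C0" unfolding C0_def using T by simp
  have near: "- C0 \<le> e v" if v: "v \<in> dom_E" "d x v \<le> 1" for v
  proof -
    have "ereal A \<le> ereal ((d u v)\<^sup>2 / (2*T) + e v)"
      using T(3)[of v] v dom_subset by (simp add: E_dom)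
    then have "A \<le> (d u v)\<^sup>2 / (2*T) + e v" by simp
    moreover have "(d u v)\<^sup>2 / (2*T) \<le> (d u x + 1)\<^sup>2 / (2*T)"
      using d_triangle[OF T(2) xX dom_subset[OF v(1)]] v d_nonneg[of u v] T
      by (intro divide_right_mono power_mono) auto
    ultimately show ?thesis unfolding C0_def by linarith
  qed
  define C where "C = C0 + \<bar>e x\<bar>"
  have "- C * (1 + d x v) - l / 2 * (d x v)\<^sup>2 \<le> e v" if v: "v \<in> dom_E" for v
  proof (cases "d x v \<le> 1")
    case True
    have "0 \<le> C * d x v" "0 \<le> l / 2 * (d x v)\<^sup>2"
      using C0 l_nonneg d_nonneg[of x v] by (auto simp: C_def)
    with near[OF v True] C0 show ?thesis by (simp add: C_def algebra_simps)
  next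
    case False
    define r where "r = d x v"
    have r: "r > 1" using False by (simp add: r_def)
    obtain \<gamma> where g: "\<And>\<alpha>. 0 \<le> \<alpha> \<Longrightarrow> \<alpha> \<le> 1 \<Longrightarrow> \<gamma> \<alpha> \<in> dom_E"
      "\<And>\<alpha>. 0 \<le> \<alpha> \<Longrightarrow> \<alpha> \<le> 1 \<Longrightarrow> d x (\<gamma> \<alpha>) \<le> \<alpha> * d x v"
      "\<And>\<alpha>. 0 \<le> \<alpha> \<Longrightarrow> \<alpha> \<le> 1 \<Longrightarrow>
        e (\<gamma> \<alpha>) \<le> (1 - \<alpha>) * e x + \<alpha> * e v + \<alpha> * (1 - \<alpha>) * l / 2 * (d x v)\<^sup>2"
      by (rule e_convex_geodesic[OF x v]) (rule that)
    \<comment> \<open>The parameter \<open>1 / r\<close> puts the curve into the unit ball. Solving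
      the convexity inequality for \<open>e v\<close> multiplies the bound on the ball by
      \<open>r\<close>, hence the linear term.\<close>
    have r': "0 \<le> 1 / r" "1 / r \<le> 1" "1 / r * r = 1" using r by auto
    have "- C0 \<le> e (\<gamma> (1 / r))"
      using g(1,2)[OF r'(1,2)] r'(3) by (intro near) (auto simp: r_def)
    also have "\<dots> \<le> (1 - 1 / r) * e x + 1 / r * e v + 1 / r * (1 - 1 / r) * l / 2 * r\<^sup>2"
      using g(3)[OF r'(1,2)] by (simp add: r_def)
    finally have "r * (- C0) \<le> r * ((1 - 1 / r) * e x + 1 / r * e v + 1 / r * (1 - 1 / r) * l / 2 * r\<^sup>2)"
      using r by (intro mult_left_mono) auto
    also have "\<dots> = (r - 1) * e x + e v + l / 2 * r\<^sup>2 - l / 2 * r"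
      using r by (simp add: field_simps power2_eq_square)
    finally have 1: "r * (- C0) \<le> (r - 1) * e x + e v + l / 2 * r\<^sup>2 - l / 2 * r" .
    have 2: "(r - 1) * e x \<le> (r - 1) * \<bar>e x\<bar>" using r by (intro mult_left_mono) auto
    have 3: "0 \<le> l / 2 * r" using l_nonneg r by simp
    show ?thesis
      using 1 2 3 C0 unfolding r_def[symmetric] C_def by (simp add: algebra_simps)
  qed
  moreover have "0 \<le> C" using C0 by (simp add: C_def)
  ultimately show thesis using that by blast
qed

text \<open>The restriction on the step is used twice: \<open>\<kappa> > 0\<close> beats the
  quadratic decay allowed by \<open>e_lower_bound\<close>, and it makes \<open>F\<close> uniformly
  convex along curves based at \<open>x\<close>.\<close>

lemma step_exists:
  assumes x: "x \<in> dom_E" and t: "0 < \<tau>" "l * \<tau> < 1"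
  shows "\<exists>y. is_step \<tau> x y"
proof -
  have xX: "x \<in> X" using x dom_subset by blast
  define \<kappa> where "\<kappa> = 1 / \<tau> - l"
  have k: "\<kappa> > 0" using t by (simp add: \<kappa>_def field_simps)
  define F where "F v = (d x v)\<^sup>2 / (2*\<tau>) + e v" for v
  obtain C where C: "0 \<le> C" "\<And>v. v \<in> dom_E \<Longrightarrow> - C * (1 + d x v) - l / 2 * (d x v)\<^sup>2 \<le> e v"
    using e_lower_bound[OF x] by blast
  \<comment> \<open>The term \<open>- C\<^sup>2 / (2 * \<kappa>)\<close> is the minimum of
    \<open>\<kappa> / 2 * r\<^sup>2 - C * r\<close> over \<open>r\<close>.\<close>
  have F_bound: "- C - C\<^sup>2 / (2 * \<kappa>) \<le> F v" if "v \<in> dom_E" for v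
  proof -
    have "0 \<le> (\<kappa> * d x v - C)\<^sup>2 / (2 * \<kappa>)" using k by simp
    then have "0 \<le> \<kappa> / 2 * (d x v)\<^sup>2 - C * d x v + C\<^sup>2 / (2 * \<kappa>)"
      using k by (simp add: power2_eq_square field_simps)
    moreover have "\<kappa> / 2 * (d x v)\<^sup>2 = (d x v)\<^sup>2 / (2*\<tau>) - l / 2 * (d x v)\<^sup>2"
      by (simp add: \<kappa>_def algebra_simps diff_divide_distrib)
    ultimately show ?thesis
      using C(2)[OF that] by (simp add: F_def algebra_simps)
  qed
  then have bdd: "bdd_below (F ` dom_E)" by (auto intro!: bdd_belowI)
  define I where "I = (INF v\<in>dom_E. F v)"
  have I: "I \<le> F v" if "v \<in> dom_E" for v
    unfolding I_def using bdd that by (rule cINF_lower)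
  have "\<exists>v\<in>dom_E. F v < I + 1 / real (Suc k)" for k
    using cINF_less_iff[of dom_E F "I + 1 / real (Suc k)"] bdd x by (auto simp: I_def)
  then obtain s where s: "\<And>k. s k \<in> dom_E" "\<And>k. F (s k) < I + 1 / real (Suc k)" by metis
  \<comment> \<open>At the midpoint \<open>F\<close> lies at least \<open>\<kappa> / 8 * K\<close>
    below the mean of \<open>F u\<close> and \<open>F v\<close>, yet not below
    \<open>I\<close>.\<close>
  have gap: "(d u v)\<^sup>2 \<le> 4 / \<kappa> * ((F u - I) + (F v - I))" if u: "u \<in> dom_E" and v: "v \<in> dom_E" for u v
  proof -
    obtain \<gamma> K where g: "(d u v)\<^sup>2 \<le> K"
      "\<And>\<alpha>. 0 \<le> \<alpha> \<Longrightarrow> \<alpha> \<le> 1 \<Longrightarrow> \<gamma> \<alpha> \<in> dom_E"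
      "\<And>\<alpha>. 0 \<le> \<alpha> \<Longrightarrow> \<alpha> \<le> 1 \<Longrightarrow>
          (d x (\<gamma> \<alpha>))\<^sup>2 \<le> (1 - \<alpha>) * (d x u)\<^sup>2 + \<alpha> * (d x v)\<^sup>2 - \<alpha> * (1 - \<alpha>) * K"
      "\<And>\<alpha>. 0 \<le> \<alpha> \<Longrightarrow> \<alpha> \<le> 1 \<Longrightarrow>
          e (\<gamma> \<alpha>) \<le> (1 - \<alpha>) * e u + \<alpha> * e v + \<alpha> * (1 - \<alpha>) * l / 2 * K"
      by (rule e_convex[OF xX u v]) (rule that)
    have "I \<le> F (\<gamma> (1/2))" using g(2)[of "1/2"] I by simp
    also have "\<dots> \<le> ((d x u)\<^sup>2 / 2 + (d x v)\<^sup>2 / 2 - K / 4) / (2*\<tau>) + (e u / 2 + e v / 2 + l * K / 8)"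
      unfolding F_def using g(3,4)[of "1/2"] t by (intro add_mono divide_right_mono) auto
    also have "\<dots> = (F u + F v) / 2 - \<kappa> / 8 * K"
      by (simp add: F_def \<kappa>_def algebra_simps add_divide_distrib diff_divide_distrib)
    finally have "K \<le> 4 / \<kappa> * ((F u - I) + (F v - I))"
      using k by (simp add: field_simps)
    with g(1) show ?thesis by simp
  qed
  have "\<exists>y\<in>X. (\<lambda>k. d (s k) y) \<longlonglongrightarrow> 0"
  proof (rule d_complete)
    fix \<epsilon> :: real assume e: "0 < \<epsilon>"
    obtain N where N: "8 / \<kappa> / \<epsilon>\<^sup>2 < real N" using reals_Archimedean2 by blast
    have "d (s i) (s j) < \<epsilon>" if ij: "N \<le> i" "N \<le> j" for i j
    proof -
      have N0: "real N > 0" using N k e by (smt (verit) divide_pos_pos zero_less_power)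
      have "F (s i) - I < 1 / real N"
        using s(2)[of i] ij N0 by (smt (verit, best) frac_le of_nat_Suc of_nat_mono)
      moreover have "F (s j) - I < 1 / real N"
        using s(2)[of j] ij N0 by (smt (verit, best) frac_le of_nat_Suc of_nat_mono)
      ultimately have "4 / \<kappa> * ((F (s i) - I) + (F (s j) - I)) < 4 / \<kappa> * (2 / real N)"
        using k by (intro mult_strict_left_mono) auto
      also have "\<dots> < \<epsilon>\<^sup>2" using N N0 e k by (simp add: field_simps)
      finally have "(d (s i) (s j))\<^sup>2 < \<epsilon>\<^sup>2" using gap[OF s(1) s(1), of i j] by linarith
      then show ?thesis using e by (simp add: power2_less_imp_less)
    qed
    then show "\<exists>N. \<forall>i\<ge>N. \<forall>j\<ge>N. d (s i) (s j) < \<epsilon>" by blast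
  qed (use s dom_subset in auto)
  then obtain y where y: "y \<in> X" "(\<lambda>k. d (s k) y) \<longlonglongrightarrow> 0" by blast
  have dconv: "(\<lambda>k. d x (s k)) \<longlonglongrightarrow> d x y"
  proof (rule LIM_zero_cancel, rule Lim_null_comparison[OF _ y(2)], rule always_eventually, rule allI)
    fix k
    show "norm (d x (s k) - d x y) \<le> d (s k) y"
      using d_triangle[OF xX y(1) dom_subset[OF s(1)[of k]]] d_triangle[OF xX dom_subset[OF s(1)[of k]] y(1)]
        d_sym[OF y(1) dom_subset[OF s(1)[of k]]] by auto
  qed
  \<comment> \<open>Lower semicontinuity concerns the energy alone, so the distance term, which
    converges, is first moved to the other side.\<close>
  have Ey: "E y \<le> ereal (I + \<epsilon> - (d x y)\<^sup>2 / (2*\<tau>))" if e: "0 < \<epsilon>" for \<epsilon>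
  proof (rule e_lsc[OF y(1) s(1) y(2)])
    have "(\<lambda>k. I + 1 / real (Suc k) - (d x (s k))\<^sup>2 / (2*\<tau>)) \<longlonglongrightarrow> I + 0 - (d x y)\<^sup>2 / (2*\<tau>)"
      using t by (intro tendsto_intros dconv LIMSEQ_Suc[OF lim_1_over_n]) auto
    then have "eventually (\<lambda>k. I + 1 / real (Suc k) - (d x (s k))\<^sup>2 / (2*\<tau>) < I + \<epsilon> - (d x y)\<^sup>2 / (2*\<tau>)) sequentially"
      by (rule order_tendstoD) (use e in auto)
    then show "eventually (\<lambda>k. e (s k) \<le> I + \<epsilon> - (d x y)\<^sup>2 / (2*\<tau>)) sequentially"
    proof eventually_elim
      case (elim k)
      then show ?case using s(2)[of k] unfolding F_def by linarith
    qed
  qed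
  have yd: "y \<in> dom_E" using in_domI[OF y(1) Ey[of 1]] by simp
  have "F y \<le> I + \<epsilon>" if "0 < \<epsilon>" for \<epsilon>
    using Ey[OF that] E_dom[OF yd] by (simp add: F_def)
  then have Fy: "F y \<le> I" by (rule field_le_epsilon)
  have "is_step \<tau> x y"
    unfolding is_step_def
  proof (intro conjI ballI y(1))
    fix v assume v: "v \<in> X"
    show "ereal ((d x y)\<^sup>2 / (2*\<tau>)) + E y \<le> ereal ((d x v)\<^sup>2 / (2*\<tau>)) + E v"
    proof (cases "v \<in> dom_E")
      case True
      then show ?thesis using Fy I[OF True] E_dom[OF yd] E_dom[OF True] by (simp add: F_def)
    next
      case False
      then have "E v = \<infinity>" using v by (auto simp: dom_E_def)
      then show ?thesis by simp
    qed
  qed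
  then show ?thesis by blast
qed

section \<open>The metric slope and the length of the steps\<close>

definition slope_bound :: "'b \<Rightarrow> real \<Rightarrow> bool" where
  "slope_bound x S \<longleftrightarrow> (\<forall>v\<in>dom_E. e x - e v \<le> S * d x v + l / 2 * (d x v)\<^sup>2)"

text \<open>Convexity carries the local information out to any \<open>v\<close>: the energy drop
  from \<open>x\<close> to \<open>v\<close> is at most \<open>1 / \<alpha>\<close> times the drop
  along the geodesic up to \<alpha>, apart from the term with \<open>l\<close>, and for small
  \<alpha> the slope controls the latter.\<close>

lemma slope_boundI:
  assumes x: "x \<in> dom_E"
    and slope: "\<And>\<epsilon>. 0 < \<epsilon> \<Longrightarrow> \<exists>r>0. \<forall>v\<in>dom_E. 0 < d x v \<and> d x v < r \<longrightarrow> e x - e v \<le> (S + \<epsilon>) * d x v"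
    and S: "0 \<le> S"
  shows "slope_bound x S"
  unfolding slope_bound_def
proof
  fix v assume v: "v \<in> dom_E"
  have xX: "x \<in> X" using x dom_subset by blast
  obtain \<gamma> where g: "\<And>\<alpha>. 0 \<le> \<alpha> \<Longrightarrow> \<alpha> \<le> 1 \<Longrightarrow> \<gamma> \<alpha> \<in> dom_E"
      "\<And>\<alpha>. 0 \<le> \<alpha> \<Longrightarrow> \<alpha> \<le> 1 \<Longrightarrow> d x (\<gamma> \<alpha>) \<le> \<alpha> * d x v"
      "\<And>\<alpha>. 0 \<le> \<alpha> \<Longrightarrow> \<alpha> \<le> 1 \<Longrightarrow>
        e (\<gamma> \<alpha>) \<le> (1 - \<alpha>) * e x + \<alpha> * e v + \<alpha> * (1 - \<alpha>) * l / 2 * (d x v)\<^sup>2"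
    by (rule e_convex_geodesic[OF x v]) (rule that)
  have eps: "e x - e v \<le> (S + \<epsilon>) * d x v + l / 2 * (d x v)\<^sup>2" if e: "0 < \<epsilon>" for \<epsilon>
  proof -
    obtain r where r: "r > 0" "\<And>v. v \<in> dom_E \<Longrightarrow> 0 < d x v \<Longrightarrow> d x v < r \<Longrightarrow> e x - e v \<le> (S + \<epsilon>) * d x v"
      using slope[OF e] by blast
    \<comment> \<open>Small enough to bring \<open>\<gamma> \<alpha>\<close> strictly inside the
      ball of radius \<open>r\<close>; the \<open>+ 1\<close> covers
      \<open>d x v = 0\<close>.\<close>
    define \<alpha> where "\<alpha> = min 1 (r / (2 * (d x v + 1)))"
    have a: "0 < \<alpha>" "\<alpha> \<le> 1" using r d_nonneg[of x v] by (auto simp: \<alpha>_def)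
    have "\<alpha> * d x v \<le> r / (2 * (d x v + 1)) * d x v"
      using d_nonneg[of x v] by (intro mult_right_mono) (auto simp: \<alpha>_def)
    also have "\<dots> < r" using r d_nonneg[of x v] by (simp add: field_simps) (smt (verit) mult_nonneg_nonneg)
    finally have ar: "\<alpha> * d x v < r" .
    have *: "e x - e (\<gamma> \<alpha>) \<le> (S + \<epsilon>) * (\<alpha> * d x v)"
    proof (cases "d x (\<gamma> \<alpha>) = 0")
      case True
      then have "e x \<le> e (\<gamma> \<alpha>)"
        using e_le_of_d_eq_0[OF xX g(1)[of \<alpha>]] a E_dom[OF x] by simp
      moreover have "0 \<le> (S + \<epsilon>) * (\<alpha> * d x v)" using S e a d_nonneg by simp
      ultimately show ?thesis by linarith
    next
      case False
      then have "e x - e (\<gamma> \<alpha>) \<le> (S + \<epsilon>) * d x (\<gamma> \<alpha>)"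
        using r(2)[of "\<gamma> \<alpha>"] g(1,2)[of \<alpha>] a ar d_nonneg[of x "\<gamma> \<alpha>"] by simp
      also have "\<dots> \<le> (S + \<epsilon>) * (\<alpha> * d x v)"
        using g(2)[of \<alpha>] a S e by (intro mult_left_mono) auto
      finally show ?thesis .
    qed
    have "\<alpha> * (1 - \<alpha>) * l / 2 * (d x v)\<^sup>2 \<le> \<alpha> * 1 * l / 2 * (d x v)\<^sup>2"
      using a l_nonneg by (intro mult_right_mono divide_right_mono mult_left_mono) auto
    then have "\<alpha> * (e x - e v) \<le> \<alpha> * ((S + \<epsilon>) * d x v + l / 2 * (d x v)\<^sup>2)"
      using * g(3)[of \<alpha>] a by (simp add: algebra_simps diff_divide_distrib)
    then show ?thesis using a by simp
  qed
  show "e x - e v \<le> S * d x v + l / 2 * (d x v)\<^sup>2"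
  proof (rule field_le_epsilon)
    fix \<delta> :: real assume "0 < \<delta>"
    then have "e x - e v \<le> (S + \<delta> / (d x v + 1)) * d x v + l / 2 * (d x v)\<^sup>2"
      using d_nonneg[of x v] by (intro eps) auto
    moreover have "\<delta> / (d x v + 1) * d x v \<le> \<delta>"
      using \<open>0 < \<delta>\<close> d_nonneg[of x v] by (simp add: field_simps)
    ultimately show "e x - e v \<le> S * d x v + l / 2 * (d x v)\<^sup>2 + \<delta>"
      by (simp add: algebra_simps)
  qed
qed

text \<open>Testing the variational inequality with the starting point leaves twice the squared step
  length minus \<open>l * \<tau>\<close> times it on the left; the slope bound contributes
  \<open>l * \<tau>\<close> once more, so half of the total is
  \<open>1 - l * \<tau>\<close>.\<close>

lemma first_step_le_slope:
  assumes x: "x \<in> dom_E" and t: "0 < \<tau>" "l * \<tau> < 1" and step: "is_step \<tau> x y"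
    and S: "slope_bound x S" "0 \<le> S"
  shows "(1 - l * \<tau>) * d x y \<le> \<tau> * S"
proof -
  have y: "y \<in> dom_E" using is_step_dom[OF x step] .
  have yx: "d y x = d x y" "d x x = 0" using x y dom_subset d_sym d_refl by auto
  have "(d x y)\<^sup>2 + (1 - l * \<tau>) * (d x y)\<^sup>2 \<le> 2 * \<tau> * (e x - e y)"
    using step_evi[OF x x t step] by (simp add: yx)
  also have "\<dots> \<le> 2 * \<tau> * (S * d x y + l / 2 * (d x y)\<^sup>2)"
    using S(1) y t by (intro mult_left_mono) (auto simp: slope_bound_def)
  finally have "(1 - l * \<tau>) * d x y * d x y \<le> \<tau> * S * d x y"
    by (simp add: algebra_simps power2_eq_square)
  then show ?thesis
    using d_nonneg[of x y] t S(2) by (cases "d x y = 0") auto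
qed

text \<open>The first step is tested with \<open>z\<close> and the second with its own starting
  point \<open>y\<close>. The energies cancel, and the triangle inequality for \<open>d x z\<close>
  removes the pure squares. This is a discrete form of the decay of the speed along a gradient
  flow.\<close>

lemma step_length_growth:
  assumes x: "x \<in> dom_E" and t: "0 < \<tau>" "l * \<tau> < 1" and step: "is_step \<tau> x y" "is_step \<tau> y z"
  shows "(1 - l * \<tau>) * d y z \<le> d x y"
proof -
  have y: "y \<in> dom_E" using is_step_dom[OF x step(1)] .
  have z: "z \<in> dom_E" using is_step_dom[OF y step(2)] .
  have yz: "d z y = d y z" "d y y = 0" using z y dom_subset d_sym d_refl by auto
  have "(d x y)\<^sup>2 + (1 - l * \<tau>) * (d y z)\<^sup>2 - (d x z)\<^sup>2 \<le> 2 * \<tau> * (e z - e y)"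
    by (rule step_evi[OF x z t step(1)])
  moreover have "(d y z)\<^sup>2 + (1 - l * \<tau>) * (d y z)\<^sup>2 \<le> 2 * \<tau> * (e y - e z)"
    using step_evi[OF y y t step(2)] by (simp add: yz)
  moreover have "(d x z)\<^sup>2 \<le> (d x y + d y z)\<^sup>2"
    using d_triangle[of x y z] d_nonneg x y z dom_subset by (intro power_mono) auto
  ultimately have "(1 - l * \<tau>) * d y z * d y z \<le> d x y * d y z"
    by (simp add: algebra_simps power2_eq_square)
  then show ?thesis
    using d_nonneg[of y z] d_nonneg[of x y] by (cases "d y z = 0") auto
qed

text \<open>Step number \<open>k + 1\<close> has length at most
  \<open>\<tau> * S / (1 - l * \<tau>) ^ (k + 1)\<close>. The triangle inequality sums these, with
  every power rounded up to the last one.\<close>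

lemma iterate_distance_start:
  assumes x0: "xs 0 \<in> dom_E" and t: "0 < \<tau>" "l * \<tau> < 1" and step: "\<And>n. is_step \<tau> (xs n) (xs (Suc n))"
    and S: "slope_bound (xs 0) S" "0 \<le> S"
  shows "(1 - l * \<tau>) ^ n * d (xs 0) (xs n) \<le> real n * \<tau> * S"
proof -
  define p where "p = 1 - l * \<tau>"
  have p: "0 < p" "p \<le> 1" using t l_nonneg by (auto simp: p_def)
  have dm: "xs n \<in> dom_E" for n
    by (induction n) (use x0 is_step_dom step in auto)
  have inc: "p ^ Suc n * d (xs n) (xs (Suc n)) \<le> \<tau> * S" for n
  proof (induction n)
    case 0
    then show ?case using first_step_le_slope[OF x0 t step S] by (simp add: p_def)
  next
    case (Suc n)
    have "p ^ Suc (Suc n) * d (xs (Suc n)) (xs (Suc (Suc n))) \<le> p ^ Suc n * d (xs n) (xs (Suc n))"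
      using mult_left_mono[OF step_length_growth[OF dm t step step, of n], of "p ^ Suc n"] p
      by (simp add: p_def mult_ac)
    with Suc show ?case by simp
  qed
  show ?thesis
  proof (induction n)
    case 0
    then show ?case using d_refl[OF dom_subset[OF x0]] by simp
  next
    case (Suc n)
    have "p ^ Suc n * d (xs 0) (xs (Suc n)) \<le> p ^ Suc n * (d (xs 0) (xs n) + d (xs n) (xs (Suc n)))"
      using d_triangle[OF dom_subset[OF dm] dom_subset[OF dm] dom_subset[OF dm]] p by (intro mult_left_mono) auto
    also have "\<dots> = p * (p ^ n * d (xs 0) (xs n)) + p ^ Suc n * d (xs n) (xs (Suc n))"
      by (simp add: algebra_simps)
    also have "\<dots> \<le> 1 * (real n * \<tau> * S) + \<tau> * S"
      by (intro add_mono[OF mult_mono inc]) (use Suc p d_nonneg in \<open>auto simp: p_def\<close>)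
    finally show ?case by (simp add: p_def algebra_simps)
  qed
qed

section \<open>Comparison of two time steps\<close>

lemma two_scheme_recursion:
  assumes xy: "x \<in> dom_E" "y \<in> dom_E" and t: "0 < \<tau>" "l * \<tau> < 1" and h: "0 < h" "l * h < 1"
    and step: "is_step \<tau> x x'" "is_step h y y'"
  shows "(h * (1 - l * \<tau>) + \<tau> * (1 - l * h)) * (d x' y')\<^sup>2 \<le> h * (d x y')\<^sup>2 + \<tau> * (d x' y)\<^sup>2"
proof -
  have x': "x' \<in> dom_E" and y': "y' \<in> dom_E" using is_step_dom xy step by blast+
  have sym: "d y' x' = d x' y'" "d y x' = d x' y" using d_sym dom_subset xy x' y' by auto
  \<comment> \<open>The weights \<open>h\<close> and \<open>\<tau>\<close> give both energy
    differences the factor \<open>2 * \<tau> * h\<close>, with opposite signs.\<close>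
  have "h * ((d x x')\<^sup>2 + (1 - l * \<tau>) * (d x' y')\<^sup>2 - (d x y')\<^sup>2) \<le> h * (2 * \<tau> * (e y' - e x'))"
    using step_evi[OF xy(1) y' t step(1)] h by (intro mult_left_mono) auto
  moreover have "\<tau> * ((d y y')\<^sup>2 + (1 - l * h) * (d x' y')\<^sup>2 - (d x' y)\<^sup>2) \<le> \<tau> * (2 * h * (e x' - e y'))"
    using step_evi[OF xy(2) x' h step(2)] t sym by (intro mult_left_mono) auto
  moreover have "0 \<le> h * (d x x')\<^sup>2" "0 \<le> \<tau> * (d y y')\<^sup>2" using t h by auto
  ultimately show ?thesis by (simp add: algebra_simps)
qed

end

text \<open>For \<open>l = 0\<close> read the recursion as a walk that lowers \<open>n\<close> with
  probability \<open>h / (h + \<tau>)\<close> and \<open>m\<close> with probability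
  \<open>\<tau> / (h + \<tau>)\<close>. The time gap \<open>n * \<tau> - m * h\<close> is then a
  martingale whose square grows by \<open>\<tau> * h\<close> per step on average, and
  \<open>n * \<tau>\<^sup>2 + m * h\<^sup>2\<close> drops by the same amount. So the sum solves the
  recursion exactly.\<close>

definition kobayashi :: "real \<Rightarrow> real \<Rightarrow> nat \<Rightarrow> nat \<Rightarrow> real" where
  "kobayashi \<tau> h n m = (real n * \<tau> - real m * h)\<^sup>2 + real n * \<tau>\<^sup>2 + real m * h\<^sup>2"

lemma kobayashi_recursion:
  fixes l \<tau> h :: real
  assumes "0 \<le> l" "0 < \<tau>" "0 < h" and p: "p = 1 - l * \<tau>" "0 < p" and q: "q = 1 - l * h" "0 < q"
  shows "h * p\<^sup>2 * kobayashi \<tau> h n (Suc m) + \<tau> * q\<^sup>2 * kobayashi \<tau> h (Suc n) m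
    \<le> (h * p + \<tau> * q) * kobayashi \<tau> h (Suc n) (Suc m)"
proof -
  define a where "a = real (Suc n) * \<tau> - real (Suc m) * h"
  define c where "c = real n * \<tau>\<^sup>2 + real m * h\<^sup>2"
  have c: "0 \<le> c" by (simp add: c_def)
  have k: "kobayashi \<tau> h n (Suc m) = (a - \<tau>)\<^sup>2 + c + h\<^sup>2"
    "kobayashi \<tau> h (Suc n) m = (a + h)\<^sup>2 + c + \<tau>\<^sup>2"
    "kobayashi \<tau> h (Suc n) (Suc m) = a\<^sup>2 + c + \<tau>\<^sup>2 + h\<^sup>2"
    by (simp_all add: kobayashi_def a_def c_def algebra_simps)
  \<comment> \<open>The surplus caused by \<open>l\<close> collects into a nonnegative expression
    because \<open>p - q = l * (h - \<tau>)\<close> and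
    \<open>h * p - \<tau> * q = h - \<tau>\<close>.\<close>
  have "(h * p + \<tau> * q) * (a\<^sup>2 + c + \<tau>\<^sup>2 + h\<^sup>2)
      - (h * p\<^sup>2 * ((a - \<tau>)\<^sup>2 + c + h\<^sup>2) + \<tau> * q\<^sup>2 * ((a + h)\<^sup>2 + c + \<tau>\<^sup>2))
    = l * h * \<tau> * (p + q) * ((a - (\<tau> - h))\<^sup>2 + c + 2 * \<tau> * h)"
    unfolding p q by (simp add: algebra_simps power2_eq_square)
  also have "\<dots> \<ge> 0" using assms c by (intro mult_nonneg_nonneg add_nonneg_nonneg) auto
  finally show ?thesis unfolding k by linarith
qed

context gg_convex_space begin

theorem two_scheme_estimate:
  assumes x0: "xs 0 \<in> dom_E" "ys 0 = xs 0" and t: "0 < \<tau>" "l * \<tau> < 1" and h: "0 < h" "l * h < 1"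
    and step: "\<And>n. is_step \<tau> (xs n) (xs (Suc n))" "\<And>n. is_step h (ys n) (ys (Suc n))"
    and S: "slope_bound (xs 0) S" "0 \<le> S"
  shows "(1 - l * \<tau>) ^ (2 * n) * (1 - l * h) ^ (2 * m) * (d (xs n) (ys m))\<^sup>2 \<le> kobayashi \<tau> h n m * S\<^sup>2"
proof -
  define p where "p = 1 - l * \<tau>"
  define q where "q = 1 - l * h"
  have p: "0 < p" "p \<le> 1" and q: "0 < q" "q \<le> 1" using t h l_nonneg by (auto simp: p_def q_def)
  have xd: "xs n \<in> dom_E" for n
    by (induction n) (use x0 is_step_dom[OF _ step(1)] in auto)
  have yd: "ys n \<in> dom_E" for n
    by (induction n) (use x0 is_step_dom[OF _ step(2)] in auto)
  \<comment> \<open>For the two boundary cases: the bound on the distance to the start is squared,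
    and \<open>real n * s\<^sup>2\<close> is added to reach the shape of
    \<open>kobayashi\<close>.\<close>
  have start: "u ^ (2 * n) * D\<^sup>2 \<le> ((real n * s)\<^sup>2 + real n * s\<^sup>2) * S\<^sup>2"
    if "u ^ n * D \<le> real n * s * S" "0 < u" "0 \<le> D" for u D s n
  proof -
    have "u ^ (2 * n) * D\<^sup>2 = (u ^ n * D)\<^sup>2" by (simp add: power_mult_distrib power_mult[symmetric] mult.commute)
    also have "\<dots> \<le> (real n * s * S)\<^sup>2" using that by (intro power_mono) auto
    also have "\<dots> \<le> ((real n * s)\<^sup>2 + real n * s\<^sup>2) * S\<^sup>2" by (simp add: power_mult_distrib algebra_simps)
    finally show ?thesis .
  qed
  have "p ^ (2 * n) * q ^ (2 * m) * (d (xs n) (ys m))\<^sup>2 \<le> kobayashi \<tau> h n m * S\<^sup>2" for n m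
  proof (induction "n + m" arbitrary: n m)
    case 0
    then show ?case using d_refl[OF dom_subset[OF x0(1)]] by (simp add: kobayashi_def x0)
  next
    case (Suc k)
    consider "m = 0" | "n = 0" | n' m' where "n = Suc n'" "m = Suc m'"
      by (metis not0_implies_Suc)
    then show ?case
    proof cases
      case 1
      have "d (xs n) (xs 0) = d (xs 0) (xs n)" using d_sym dom_subset xd by blast
      with 1 show ?thesis
        using start[OF iterate_distance_start[OF x0(1) t step(1) S, of n]] t d_nonneg
        by (simp add: kobayashi_def x0 p_def)
    next
      case 2
      have "(1 - l * h) ^ m * d (ys 0) (ys m) \<le> real m * h * S"
        using iterate_distance_start[of ys h S m] x0 h step S by simp
      with 2 show ?thesis
        using start[of "1 - l * h" m "d (ys 0) (ys m)" h] h d_nonneg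
        by (simp add: kobayashi_def x0 q_def)
    next
      case 3
      \<comment> \<open>The induction hypotheses carry the weights \<open>P * q\<^sup>2\<close> and
        \<open>P * p\<^sup>2\<close>, the goal carries \<open>P * p\<^sup>2 * q\<^sup>2\<close>. The
        missing squares are the coefficients in \<open>kobayashi_recursion\<close>.\<close>
      define P where "P = p ^ (2 * n') * q ^ (2 * m')"
      have P: "0 < P" using p q by (simp add: P_def)
      have 1: "P * q\<^sup>2 * (d (xs n') (ys m))\<^sup>2 \<le> kobayashi \<tau> h n' m * S\<^sup>2"
        using Suc.hyps(1)[of n' m] Suc.hyps(2) 3 by (simp add: P_def power2_eq_square mult_ac)
      have 2: "P * p\<^sup>2 * (d (xs n) (ys m'))\<^sup>2 \<le> kobayashi \<tau> h n m' * S\<^sup>2"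
        using Suc.hyps(1)[of n m'] Suc.hyps(2) 3 by (simp add: P_def power2_eq_square mult_ac)
      have rec: "(h * p + \<tau> * q) * (d (xs n) (ys m))\<^sup>2 \<le> h * (d (xs n') (ys m))\<^sup>2 + \<tau> * (d (xs n) (ys m'))\<^sup>2"
        using two_scheme_recursion[OF xd yd t h step] 3 by (simp add: p_def q_def)
      have "(h * p + \<tau> * q) * (p ^ (2 * n) * q ^ (2 * m) * (d (xs n) (ys m))\<^sup>2)
          = P * p\<^sup>2 * q\<^sup>2 * ((h * p + \<tau> * q) * (d (xs n) (ys m))\<^sup>2)"
        by (simp add: P_def 3 power2_eq_square mult_ac)
      also have "\<dots> \<le> P * p\<^sup>2 * q\<^sup>2 * (h * (d (xs n') (ys m))\<^sup>2 + \<tau> * (d (xs n) (ys m'))\<^sup>2)"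
        using rec P by (intro mult_left_mono) auto
      also have "\<dots> = h * p\<^sup>2 * (P * q\<^sup>2 * (d (xs n') (ys m))\<^sup>2) + \<tau> * q\<^sup>2 * (P * p\<^sup>2 * (d (xs n) (ys m'))\<^sup>2)"
        by (simp add: algebra_simps)
      also have "\<dots> \<le> h * p\<^sup>2 * (kobayashi \<tau> h n' m * S\<^sup>2) + \<tau> * q\<^sup>2 * (kobayashi \<tau> h n m' * S\<^sup>2)"
        using 1 2 t h by (intro add_mono mult_left_mono) auto
      also have "\<dots> = (h * p\<^sup>2 * kobayashi \<tau> h n' m + \<tau> * q\<^sup>2 * kobayashi \<tau> h n m') * S\<^sup>2"
        by (simp add: algebra_simps)
      also have "\<dots> \<le> ((h * p + \<tau> * q) * kobayashi \<tau> h n m) * S\<^sup>2"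
        unfolding 3
        by (intro mult_right_mono kobayashi_recursion[OF l_nonneg t(1) h(1) p_def p(1) q_def q(1)]) auto
      finally have "(h * p + \<tau> * q) * (p ^ (2 * n) * q ^ (2 * m) * (d (xs n) (ys m))\<^sup>2)
          \<le> (h * p + \<tau> * q) * (kobayashi \<tau> h n m * S\<^sup>2)" by (simp only: mult.assoc)
      moreover have "0 < h * p + \<tau> * q" using h t p q by (intro add_pos_pos mult_pos_pos)
      ultimately show ?thesis by (rule mult_left_le_imp_le)
    qed
  qed
  then show ?thesis by (simp add: p_def q_def)
qed

end

section \<open>A space-filling curve and Prokhorov's theorem\<close>

definition binary_digit :: "real \<Rightarrow> nat \<Rightarrow> real" where
  "binary_digit u k = of_int \<lfloor>2 ^ Suc k * u\<rfloor> - 2 * of_int \<lfloor>2 ^ k * u\<rfloor>"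

lemma binary_digit_cases: "binary_digit u k = 0 \<or> binary_digit u k = 1"
proof -
  have "\<lfloor>2 * y\<rfloor> = 2 * \<lfloor>y\<rfloor> \<or> \<lfloor>2 * y\<rfloor> = 2 * \<lfloor>y\<rfloor> + 1" for y :: real
    by linarith
  from this[of "2 ^ k * u"] show ?thesis
    unfolding binary_digit_def by (auto simp: mult.assoc)
qed

text \<open>The partial sums telescope to the dyadic truncations of \<open>u\<close>; the
  telescoping starts at 0 because the integer part of \<open>u\<close> vanishes.\<close>

lemma binary_digit_sums:
  assumes "0 \<le> u" "u < 1"
  shows "(\<lambda>k. binary_digit u k / 2 ^ Suc k) sums u"
proof -
  have part: "(\<Sum>k<n. binary_digit u k / 2 ^ Suc k) = of_int \<lfloor>2 ^ n * u\<rfloor> / 2 ^ n" for n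
  proof (induction n)
    case 0
    have "\<lfloor>u\<rfloor> = 0" using assms by linarith
    then show ?case by simp
  next
    case (Suc n)
    then show ?case by (simp add: binary_digit_def field_simps)
  qed
  have "(\<lambda>n. of_int \<lfloor>2 ^ n * u\<rfloor> / 2 ^ n) \<longlonglongrightarrow> u"
  proof (rule LIM_zero_cancel, rule Lim_null_comparison)
    show "(\<lambda>n. (1/2::real) ^ n) \<longlonglongrightarrow> 0" by (rule LIMSEQ_power_zero) simp
    show "\<forall>\<^sub>F n in sequentially. norm (of_int \<lfloor>2 ^ n * u\<rfloor> / 2 ^ n - u) \<le> (1/2) ^ n"
    proof (intro always_eventually allI)
      fix n :: nat
      have "\<bar>of_int \<lfloor>2 ^ n * u\<rfloor> - 2 ^ n * u\<bar> \<le> 1" by linarith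
      then have "\<bar>of_int \<lfloor>2 ^ n * u\<rfloor> - 2 ^ n * u\<bar> / 2 ^ n \<le> 1 / 2 ^ n"
        by (intro divide_right_mono) auto
      also have "\<bar>of_int \<lfloor>2 ^ n * u\<rfloor> - 2 ^ n * u\<bar> / 2 ^ n = \<bar>(of_int \<lfloor>2 ^ n * u\<rfloor> - 2 ^ n * u) / 2 ^ n\<bar>"
        by simp
      also have "(of_int \<lfloor>2 ^ n * u\<rfloor> - 2 ^ n * u) / 2 ^ n = of_int \<lfloor>2 ^ n * u\<rfloor> / 2 ^ n - u"
        by (simp add: diff_divide_distrib)
      finally show "norm (of_int \<lfloor>2 ^ n * u\<rfloor> / 2 ^ n - u) \<le> (1/2) ^ n"
        by (simp add: power_one_over)
    qed
  qed
  then show ?thesis unfolding sums_def part .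
qed

text \<open>The point of the Cantor set with ternary digits \<open>2 * a j\<close>. The digit 1
  never occurs, which leaves gaps in which a continuous function can switch between two
  values.\<close>

definition cantor_sum :: "(nat \<Rightarrow> real) \<Rightarrow> real" where
  "cantor_sum a = (\<Sum>j. 2 * a j / 3 ^ Suc j)"

lemma cantor_sum_summable:
  assumes "\<And>j. a j = 0 \<or> a j = (1::real)"
  shows "summable (\<lambda>j. 2 * a j / 3 ^ Suc j)"
proof (rule summable_comparison_test)
  show "summable (\<lambda>j. (1/3::real) ^ j)" by (rule summable_geometric) simp
  show "\<exists>N. \<forall>n\<ge>N. norm (2 * a n / 3 ^ Suc n) \<le> (1/3) ^ n"
  proof (intro exI[of _ 0] allI impI)
    fix n
    show "norm (2 * a n / 3 ^ Suc n) \<le> (1/3) ^ n"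
      using assms[of n] by (auto simp: power_one_over field_simps)
  qed
qed

lemma cantor_sum_step:
  assumes "\<And>j. a j = 0 \<or> a j = (1::real)"
  shows "3 * cantor_sum a = 2 * a 0 + cantor_sum (\<lambda>j. a (Suc j))"
proof -
  note s = cantor_sum_summable[of a, OF assms]
  have "cantor_sum a = 2 * a 0 / 3 + (\<Sum>j. 2 * a (Suc j) / 3 ^ Suc (Suc j))"
    unfolding cantor_sum_def using suminf_split_head[OF s] by simp
  also have "(\<Sum>j. 2 * a (Suc j) / 3 ^ Suc (Suc j)) = cantor_sum (\<lambda>j. a (Suc j)) / 3"
    unfolding cantor_sum_def
    using suminf_divide[OF cantor_sum_summable[of "\<lambda>j. a (Suc j)"], of 3] assms by (simp add: mult_ac)
  finally show ?thesis by simp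
qed

lemma cantor_sum_bounds:
  assumes "\<And>j. a j = 0 \<or> a j = (1::real)"
  shows "0 \<le> cantor_sum a" "cantor_sum a \<le> 1"
proof -
  note s = cantor_sum_summable[of a, OF assms]
  have a: "0 \<le> a j" "a j \<le> 1" for j using assms[of j] by auto
  show "0 \<le> cantor_sum a" unfolding cantor_sum_def by (rule suminf_nonneg[OF s]) (use a in auto)
  have g: "(\<lambda>j. 2 / 3 * (1/3::real) ^ j) sums (2 / 3 * (1 / (1 - 1/3)))"
    by (intro sums_mult geometric_sums) simp
  have "cantor_sum a \<le> (\<Sum>j. 2 / 3 * (1/3::real) ^ j)"
    unfolding cantor_sum_def
    by (intro suminf_le s sums_summable[OF g]) (use a in \<open>auto simp: power_one_over divide_simps\<close>)
  also have "\<dots> = 1" using sums_unique[OF g] by simp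
  finally show "cantor_sum a \<le> 1" .
qed

text \<open>A truncated cosine in the role of Schoenberg's piecewise linear function: it is even,
  has period 2, vanishes on \<open>[0, 1/3]\<close> and equals 1 on \<open>[2/3, 1]\<close>.\<close>

definition fold_wave :: "real \<Rightarrow> real" where
  "fold_wave u = min 1 (max 0 (1/2 - cos (pi * u)))"

lemma cos_pi_shift: "cos (pi * (2 * of_int M + s)) = cos (pi * s)"
proof -
  have "pi * (2 * of_int M + s) = 2 * pi * of_int M + pi * s" by (simp add: algebra_simps)
  then show ?thesis by (simp add: cos_add cos_int_2pin sin_int_2pin)
qed

text \<open>Multiplication by \<open>3 ^ k\<close> shifts the ternary expansion. The digits moved in
  front of the point are 0 or 2, so they form an even integer, which the period absorbs; the first
  remaining digit decides in which outer third of the unit interval the rest lies.\<close>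

lemma fold_wave_cantor_sum:
  assumes "\<And>j. a j = 0 \<or> a j = (1::real)"
  shows "fold_wave (3 ^ k * (2 * of_int N + cantor_sum a)) = a k"
proof -
  have "\<exists>M::int. 3 ^ k * cantor_sum a = 2 * of_int M + cantor_sum (\<lambda>j. a (j + k))"
  proof (induction k)
    case 0
    show ?case by (rule exI[of _ 0]) simp
  next
    case (Suc k)
    then obtain M :: int where M: "3 ^ k * cantor_sum a = 2 * of_int M + cantor_sum (\<lambda>j. a (j + k))" by blast
    have "3 ^ Suc k * cantor_sum a = 2 * (3 * of_int M + a k) + cantor_sum (\<lambda>j. a (j + Suc k))"
      using M cantor_sum_step[of "\<lambda>j. a (j + k)"] assms by simp
    moreover have "a k = of_int (if a k = 0 then 0 else 1)" using assms[of k] by auto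
    ultimately show ?case by (intro exI[of _ "3 * M + (if a k = 0 then 0 else 1)"]) simp
  qed
  then obtain M :: int where M: "3 ^ k * cantor_sum a = 2 * of_int M + cantor_sum (\<lambda>j. a (j + k))" by blast
  define s where "s = cantor_sum (\<lambda>j. a (j + k))"
  have "3 ^ k * (2 * of_int N + cantor_sum a) = 2 * of_int (3 ^ k * N + M) + s"
    using M by (simp add: algebra_simps s_def)
  then have w: "fold_wave (3 ^ k * (2 * of_int N + cantor_sum a)) = min 1 (max 0 (1/2 - cos (pi * s)))"
    unfolding fold_wave_def by (simp only: cos_pi_shift)
  have s: "3 * s = 2 * a k + cantor_sum (\<lambda>j. a (Suc (j + k)))"
    using cantor_sum_step[of "\<lambda>j. a (j + k)"] assms by (simp add: s_def)
  have b: "0 \<le> cantor_sum (\<lambda>j. a (Suc (j + k)))" "cantor_sum (\<lambda>j. a (Suc (j + k))) \<le> 1"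
    using cantor_sum_bounds[of "\<lambda>j. a (Suc (j + k))"] assms by auto
  show ?thesis
  proof (cases "a k = 0")
    case True
    then have "0 \<le> s" "s \<le> 1/3" using s b by auto
    then have "cos (pi / 3) \<le> cos (pi * s)"
      by (intro cos_monotone_0_pi_le) (auto simp: field_simps)
    then show ?thesis using w True by (simp add: cos_60)
  next
    case False
    then have "a k = 1" using assms by blast
    then have "2/3 \<le> s" "s \<le> 1" using s b by auto
    then have "cos (pi * s) \<le> cos (2 / 3 * pi)"
      by (intro cos_monotone_0_pi_le) (auto simp: field_simps)
    also have "\<dots> = - (1/2)" by (simp add: cos_120)
    finally show ?thesis using w \<open>a k = 1\<close> by simp
  qed
qed

definition stair :: "real \<Rightarrow> real" where
  "stair t = (t - arccos (cos (pi * t)) / pi) / 2"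

text \<open>\<open>arccos (cos (pi * t)) / pi\<close> is the distance from \<open>t\<close> to the
  nearest even integer. Hence \<open>stair\<close> is flat on the intervals where
  \<open>schoenberg_section\<close> takes its values and climbs by 1 between them.\<close>

lemma stair_eq:
  assumes "0 \<le> s" "s \<le> 1"
  shows "stair (2 * of_int N + s) = of_int N"
proof -
  have "arccos (cos (pi * s)) = pi * s" using assms by (intro arccos_cos) auto
  then show ?thesis unfolding stair_def cos_pi_shift by simp
qed

lemma continuous_stair: "continuous_on UNIV stair"
  unfolding stair_def[abs_def] by (intro continuous_intros) auto

section \<open>Schoenberg's curve and its section\<close>

definition schoenberg_coord :: "nat \<Rightarrow> real \<Rightarrow> real" where
  "schoenberg_coord i t = (\<Sum>k. fold_wave (3 ^ prod_encode (i, k) * t) / 2 ^ Suc k)"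

lemma continuous_schoenberg_coord: "continuous_on UNIV (schoenberg_coord i)"
proof -
  have "uniform_limit UNIV (\<lambda>n t. \<Sum>k<n. fold_wave (3 ^ prod_encode (i, k) * t) / 2 ^ Suc k)
     (\<lambda>t. \<Sum>k. fold_wave (3 ^ prod_encode (i, k) * t) / 2 ^ Suc k) sequentially"
  proof (rule Weierstrass_m_test)
    show "summable (\<lambda>k. (1/2::real) ^ Suc k)" by (subst summable_Suc_iff) (rule summable_geometric, simp)
    show "norm (fold_wave (3 ^ prod_encode (i, k) * t) / 2 ^ Suc k) \<le> (1/2) ^ Suc k" for k t
    proof -
      have "\<bar>fold_wave (3 ^ prod_encode (i, k) * t)\<bar> \<le> 1" by (auto simp: fold_wave_def)
      then have "\<bar>fold_wave (3 ^ prod_encode (i, k) * t)\<bar> / 2 ^ Suc k \<le> 1 / 2 ^ Suc k"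
        by (intro divide_right_mono) auto
      then show ?thesis by (simp add: power_one_over)
    qed
  qed
  then have "continuous_on UNIV (\<lambda>t. \<Sum>k. fold_wave (3 ^ prod_encode (i, k) * t) / 2 ^ Suc k)"
  proof (rule uniform_limit_theorem[rotated])
    show "\<forall>\<^sub>F n in sequentially. continuous_on UNIV (\<lambda>t. \<Sum>k<n. fold_wave (3 ^ prod_encode (i, k) * t) / 2 ^ Suc k)"
      unfolding fold_wave_def by (intro always_eventually allI continuous_intros) auto
  qed simp
  then show ?thesis by (simp add: schoenberg_coord_def[abs_def])
qed

text \<open>Schoenberg's space-filling curve: the coordinates of the point are read off the ternary digits of
  the parameter. The even integer part of the parameter records the size of the point, so that bounded
  sets have bounded preimages under the section.\<close>

definition schoenberg_curve :: "real \<Rightarrow> 'b::euclidean_space" where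
  "schoenberg_curve t = (\<Sum>b\<in>Basis. (stair t * (2 * schoenberg_coord (to_nat_on Basis b) t - 1)) *\<^sub>R b)"

definition schoenberg_section :: "'b::euclidean_space \<Rightarrow> real" where
  "schoenberg_section x = 2 * of_int (\<lceil>norm x\<rceil> + 1) + cantor_sum (\<lambda>j.
     binary_digit ((x \<bullet> from_nat_into Basis (fst (prod_decode j)) / of_int (\<lceil>norm x\<rceil> + 1) + 1) / 2)
       (snd (prod_decode j)))"

lemma continuous_schoenberg_curve: "continuous_on UNIV (schoenberg_curve :: real \<Rightarrow> 'b::euclidean_space)"
  unfolding schoenberg_curve_def[abs_def]
  by (intro continuous_intros continuous_stair continuous_schoenberg_coord)

lemma schoenberg_section_measurable:
  "(schoenberg_section :: 'b::euclidean_space \<Rightarrow> real) \<in> borel_measurable borel"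
  unfolding schoenberg_section_def[abs_def] cantor_sum_def binary_digit_def by measurable

text \<open>This linear growth is what carries tightness over to the line.\<close>

lemma schoenberg_section_bound: "\<bar>schoenberg_section x\<bar> \<le> 2 * norm x + 5"
proof -
  define N where "N = real_of_int (\<lceil>norm x\<rceil> + 1)"
  have "0 \<le> schoenberg_section x - 2 * N" "schoenberg_section x - 2 * N \<le> 1"
    unfolding schoenberg_section_def N_def using binary_digit_cases by (auto intro!: cantor_sum_bounds)
  moreover have "norm x \<le> N" "N < norm x + 2" unfolding N_def by linarith+
  moreover have "0 \<le> norm x" by simp
  ultimately show ?thesis by linarith
qed

lemma schoenberg_curve_section: "schoenberg_curve (schoenberg_section x) = (x::'b::euclidean_space)"
proof -
  define N where "N = \<lceil>norm x\<rceil> + 1"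
  \<comment> \<open>The strict inequality, due to the \<open>+ 1\<close>, keeps the divisor positive
    and the rescaled coordinates below 1, as \<open>binary_digit_sums\<close> demands.\<close>
  have N: "norm x < of_int N" unfolding N_def by linarith
  have N0: "0 < real_of_int N" using N norm_ge_zero[of x] by linarith
  \<comment> \<open>As \<open>from_nat_into\<close> is total, positions that belong to no basis
    vector also carry a digit 0 or 1.\<close>
  define a where "a j = binary_digit ((x \<bullet> from_nat_into Basis (fst (prod_decode j)) / of_int N + 1) / 2)
       (snd (prod_decode j))" for j
  have a: "a j = 0 \<or> a j = 1" for j unfolding a_def by (rule binary_digit_cases)
  have sec: "schoenberg_section x = 2 * of_int N + cantor_sum a"
    unfolding schoenberg_section_def a_def N_def ..
  have st: "stair (schoenberg_section x) = of_int N"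
    unfolding sec using cantor_sum_bounds[of a] a by (intro stair_eq) auto
  have coord: "schoenberg_coord (to_nat_on Basis b) (schoenberg_section x) = (x \<bullet> b / of_int N + 1) / 2"
    if b: "b \<in> Basis" for b
  proof -
    have "\<bar>x \<bullet> b\<bar> < of_int N" using Basis_le_norm[OF b, of x] N by linarith
    then have "0 \<le> (x \<bullet> b / of_int N + 1) / 2" "(x \<bullet> b / of_int N + 1) / 2 < 1"
      using N0 by (auto simp: field_simps)
    from binary_digit_sums[OF this]
    have "(\<lambda>k. binary_digit ((x \<bullet> b / of_int N + 1) / 2) k / 2 ^ Suc k) sums ((x \<bullet> b / of_int N + 1) / 2)" .
    moreover have "fold_wave (3 ^ prod_encode (to_nat_on Basis b, k) * schoenberg_section x)
       = binary_digit ((x \<bullet> b / of_int N + 1) / 2) k" for k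
      unfolding sec using fold_wave_cantor_sum[of a, OF a]
      by (simp add: a_def from_nat_into_to_nat_on countable_finite b)
    ultimately show ?thesis unfolding schoenberg_coord_def by (simp add: sums_unique[symmetric])
  qed
  have "schoenberg_curve (schoenberg_section x) = (\<Sum>b\<in>Basis. (x \<bullet> b) *\<^sub>R b)"
    unfolding schoenberg_curve_def
    by (intro sum.cong refl arg_cong2[of _ _ _ _ scaleR]) (use N0 in \<open>simp_all add: coord st field_simps\<close>)
  then show ?thesis by (simp add: euclidean_representation)
qed

section \<open>Narrow convergence and compactness\<close>

definition narrowly_converges :: "(nat \<Rightarrow> 'b::euclidean_space measure) \<Rightarrow> 'b measure \<Rightarrow> bool" where
  "narrowly_converges M L \<longleftrightarrow> (\<forall>(f::'b \<Rightarrow> real) B. continuous_on UNIV f \<longrightarrow> (\<forall>x. \<bar>f x\<bar> \<le> B) \<longrightarrow>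
     (\<lambda>n. integral\<^sup>L (M n) f) \<longlonglongrightarrow> integral\<^sup>L L f)"

text \<open>Only \<open>g\<close> has to be continuous: a test function \<open>f\<close> becomes the
  bounded continuous function \<open>f (g t)\<close> on the line, and \<open>g (c x) = x\<close>
  turns its integrals against \<open>N n\<close> back into integrals of \<open>f\<close> against
  \<open>M n\<close>. The limit \<open>K\<close> on the line may charge points outside the range of
  \<open>c\<close>; it is pushed forward by \<open>g\<close> all the same.\<close>

theorem prokhorov:
  fixes M :: "nat \<Rightarrow> 'b::euclidean_space measure"
  assumes M: "\<And>n. prob_space (M n)" "\<And>n. sets (M n) = sets borel"
    and tight: "\<And>\<epsilon>. 0 < \<epsilon> \<Longrightarrow> \<exists>R. \<forall>n. measure (M n) {x. R < norm x} < \<epsilon>"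
  obtains r L where "strict_mono r" "prob_space L" "sets L = sets borel" "narrowly_converges (M \<circ> r) L"
proof -
  define c where "c = (schoenberg_section :: 'b \<Rightarrow> real)"
  define g where "g = (schoenberg_curve :: real \<Rightarrow> 'b)"
  have c[measurable]: "c \<in> borel_measurable borel"
    unfolding c_def by (rule schoenberg_section_measurable)
  have cM[measurable]: "c \<in> borel_measurable (M n)" for n
    using c by (simp add: measurable_cong_sets[OF M(2) refl])
  have g: "continuous_on UNIV g" unfolding g_def by (rule continuous_schoenberg_curve)
  have gm[measurable]: "g \<in> borel_measurable borel" using g by (rule borel_measurable_continuous_onI)
  have gc: "g (c x) = x" for x unfolding g_def c_def by (rule schoenberg_curve_section)
  define N where "N n = distr (M n) borel c" for n
  have space: "space (M n) = UNIV" for n using sets_eq_imp_space_eq[OF M(2)] by simp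
  have "tight N"
    unfolding tight_def
  proof (intro conjI allI impI)
    fix n show "real_distribution (N n)"
      unfolding N_def using M by (intro prob_space.real_distribution_distr) auto
  next
    fix \<epsilon> :: real assume "0 < \<epsilon>"
    then obtain R where R: "\<And>n. measure (M n) {x. R < norm x} < \<epsilon>" using tight by blast
    \<comment> \<open>Exceeds the bound \<open>2 * \<bar>R\<bar> + 5\<close> for the section on the
      ball of radius \<open>\<bar>R\<bar>\<close>.\<close>
    define b where "b = 2 * \<bar>R\<bar> + 6"
    have "1 - \<epsilon> < measure (N n) {-b<..b}" for n
    proof -
      interpret prob_space "M n" by (rule M)
      have m: "{x. R < norm x} \<in> sets (M n)" unfolding M(2) by measurable
      have "1 - \<epsilon> < prob (space (M n) - {x. R < norm x})"
        using R[of n] by (subst prob_compl[OF m]) simp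
      also have "\<dots> \<le> prob (c -` {-b<..b} \<inter> space (M n))"
      proof (rule finite_measure_mono)
        show "space (M n) - {x. R < norm x} \<subseteq> c -` {-b<..b} \<inter> space (M n)"
        proof
          fix x assume x: "x \<in> space (M n) - {x. R < norm x}"
          then have "norm x \<le> R" by simp
          then have "\<bar>c x\<bar> < b" using schoenberg_section_bound[of x] unfolding c_def b_def by linarith
          then show "x \<in> c -` {-b<..b} \<inter> space (M n)" using x by auto
        qed
      qed measurable
      also have "\<dots> = measure (N n) {-b<..b}" unfolding N_def by (subst measure_distr) auto
      finally show ?thesis .
    qed
    moreover have "-b < b" by (simp add: b_def)
    ultimately show "\<exists>a b. a < b \<and> (\<forall>n. 1 - \<epsilon> < measure (N n) {a<..b})" by blast
  qed
  from tight_imp_convergent_subsubsequence[OF this strict_mono_id]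
  obtain r K where r: "strict_mono (r::nat \<Rightarrow> nat)" and K: "real_distribution K" and conv: "weak_conv_m (N \<circ> r) K"
    by auto
  interpret K: real_distribution K by (rule K)
  have real_dist: "real_distribution (N n)" for n using \<open>tight N\<close> by (simp add: tight_def)
  define L where "L = distr K borel g"
  have "narrowly_converges (M \<circ> r) L"
    unfolding narrowly_converges_def
  proof (intro allI impI)
    fix f :: "'b \<Rightarrow> real" and B assume f: "continuous_on UNIV f" "\<forall>x. \<bar>f x\<bar> \<le> B"
    have fm[measurable]: "f \<in> borel_measurable borel" using f(1) by (rule borel_measurable_continuous_onI)
    have fg: "continuous_on UNIV (\<lambda>t. f (g t))"
      using continuous_on_compose2[OF f(1) g] by simp
    have "(\<lambda>n. integral\<^sup>L ((N \<circ> r) n) (\<lambda>t. f (g t))) \<longlonglongrightarrow> integral\<^sup>L K (\<lambda>t. f (g t))"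
    proof (rule weak_conv_imp_integral_bdd_continuous_conv[OF _ K conv])
      show "isCont (\<lambda>t. f (g t)) x" for x using fg by (simp add: continuous_on_eq_continuous_at)
      show "norm (f (g x)) \<le> B" for x using f(2) by simp
    qed (use real_dist in simp)
    moreover have "integral\<^sup>L ((N \<circ> r) n) (\<lambda>t. f (g t)) = integral\<^sup>L ((M \<circ> r) n) f" for n
      unfolding N_def comp_def by (subst integral_distr) (auto simp: gc)
    moreover have "integral\<^sup>L K (\<lambda>t. f (g t)) = integral\<^sup>L L f"
      unfolding L_def by (subst integral_distr) auto
    ultimately show "(\<lambda>n. integral\<^sup>L ((M \<circ> r) n) f) \<longlonglongrightarrow> integral\<^sup>L L f" by simp
  qed
  moreover have "prob_space L" unfolding L_def by (rule K.prob_space_distr) simp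
  moreover have "sets L = sets borel" by (simp add: L_def)
  ultimately show thesis using that r by blast
qed

text \<open>Closed sets form an intersection-stable generator, and the indicator of a nonempty
  closed set is a pointwise limit of continuous functions bounded by 1.\<close>

lemma measure_eq_of_continuous_integrals:
  fixes L K :: "'b::euclidean_space measure"
  assumes L: "prob_space L" "sets L = sets borel" and K: "prob_space K" "sets K = sets borel"
    and eq: "\<And>f::'b \<Rightarrow> real. \<And>B. continuous_on UNIV f \<Longrightarrow> (\<And>x. \<bar>f x\<bar> \<le> B) \<Longrightarrow> integral\<^sup>L L f = integral\<^sup>L K f"
  shows "L = K"
proof -
  have fin: "emeasure L UNIV = 1"
    using prob_space.emeasure_space_1[OF L(1)] sets_eq_imp_space_eq[OF L(2)] by simp
  show ?thesis
  proof (rule measure_eqI_generator_eq[where \<Omega> = UNIV and E = "{S. closed S}" and A = "\<lambda>_. UNIV"])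
    interpret L: prob_space L by fact
    interpret K: prob_space K by fact
    have spL: "space L = UNIV" and spK: "space K = UNIV"
      using sets_eq_imp_space_eq[OF L(2)] sets_eq_imp_space_eq[OF K(2)] by auto
    show "Int_stable {S::'b set. closed S}" by (auto simp: Int_stable_def)
    show "sets L = sigma_sets UNIV {S. closed S}" "sets K = sigma_sets UNIV {S. closed S}"
      by (simp_all add: L(2) K(2) borel_eq_closed)
    fix X :: "'b set" assume "X \<in> {S. closed S}"
    then have X: "closed X" by simp
    show "emeasure L X = emeasure K X"
    \<comment> \<open>\<open>infdist\<close> to the empty set is 0 by convention, so the
      approximating functions would be constantly 1 there.\<close>
    proof (cases "X = {}")
      case False
      define f where "f n x = max 0 (1 - real n * infdist x X)" for n x
      have f: "continuous_on UNIV (f n)" "\<bar>f n x\<bar> \<le> 1" for n x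
        unfolding f_def by (auto intro!: continuous_intros simp: infdist_nonneg)
      have lim: "(\<lambda>n. f n x) \<longlonglongrightarrow> indicator X x" for x
      proof (cases "x \<in> X")
        case True
        then show ?thesis by (simp add: f_def)
      next
        case F: False
        then have pos: "0 < infdist x X" using in_closed_iff_infdist_zero[OF X False, of x] infdist_nonneg[of x X] by auto
        obtain N where N: "1 / infdist x X < real N" using reals_Archimedean2 by blast
        have "f n x = 0" if "n \<ge> N" for n
        proof -
          have "1 < real N * infdist x X" using N pos by (simp add: field_simps)
          also have "\<dots> \<le> real n * infdist x X" using that pos by simp
          finally show ?thesis by (simp add: f_def)
        qed
        then have "eventually (\<lambda>n. f n x = 0) sequentially" by (auto simp: eventually_sequentially)
        then show ?thesis using F by (simp add: tendsto_eventually)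
      qed
      have conv: "(\<lambda>n. integral\<^sup>L M (f n)) \<longlonglongrightarrow> measure M X" if M: "prob_space M" "sets M = sets borel" for M
      proof -
        interpret prob_space M by fact
        have sp: "space M = UNIV" using sets_eq_imp_space_eq[OF M(2)] by simp
        have [measurable]: "f n \<in> borel_measurable M" for n
          unfolding measurable_cong_sets[OF M(2) refl] using f(1) by (rule borel_measurable_continuous_onI)
        have [measurable]: "X \<in> sets M" using X M(2) by simp
        have "(\<lambda>n. integral\<^sup>L M (f n)) \<longlonglongrightarrow> integral\<^sup>L M (indicator X)"
          by (rule integral_dominated_convergence[where w = "\<lambda>_. 1"]) (use lim f(2) in auto)
        then show ?thesis by (simp add: sp)
      qed
      have "measure L X = measure K X"
        using conv[OF L] conv[OF K] eq[OF f(1) f(2)] LIMSEQ_unique by auto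
      then show ?thesis by (simp add: L.emeasure_eq_measure K.emeasure_eq_measure)
    qed simp
  qed (simp_all add: fin)
qed

section \<open>The quadratic Wasserstein distance\<close>

lemma borel_measurable_fst_snd [measurable]:
  "fst \<in> borel_measurable (borel :: ('b::euclidean_space \<times> 'c::euclidean_space) measure)"
  "snd \<in> borel_measurable (borel :: ('b::euclidean_space \<times> 'c::euclidean_space) measure)"
  by (auto intro!: borel_measurable_continuous_onI continuous_intros)

lemma emeasure_distr_eq_nn_integral:
  assumes "X \<in> measurable M N" "S \<in> sets N"
  shows "emeasure (distr M N X) S = (\<integral>\<^sup>+w. indicator S (X w) \<partial>M)"
  using assms nn_integral_distr[OF assms(1), of "indicator S"] nn_integral_indicator[of S "distr M N X"]
  by simp

lemma couplings_distr:
  assumes "prob_space \<Omega>" and X[measurable]: "X \<in> borel_measurable \<Omega>" and Y[measurable]: "Y \<in> borel_measurable \<Omega>"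
  shows "distr \<Omega> borel (\<lambda>w. (X w, Y w)) \<in> couplings (distr \<Omega> borel X) (distr \<Omega> borel Y)"
    and "tcost (distr \<Omega> borel (\<lambda>w. (X w, Y w))) = (\<integral>\<^sup>+w. ennreal ((dist (X w) (Y w))\<^sup>2) \<partial>\<Omega>)"
proof -
  have XY[measurable]: "(\<lambda>w. (X w, Y w)) \<in> borel_measurable \<Omega>" by (rule borel_measurable_Pair[OF X Y])
  interpret prob_space \<Omega> by fact
  show "distr \<Omega> borel (\<lambda>w. (X w, Y w)) \<in> couplings (distr \<Omega> borel X) (distr \<Omega> borel Y)"
    unfolding couplings_def
    by (auto simp: prob_space_distr distr_distr comp_def)
  show "tcost (distr \<Omega> borel (\<lambda>w. (X w, Y w))) = (\<integral>\<^sup>+w. ennreal ((dist (X w) (Y w))\<^sup>2) \<partial>\<Omega>)"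
    unfolding tcost_def by (subst nn_integral_distr) auto
qed

text \<open>In this form an upper bound on the distance needs only two random variables with the
  given laws on a common probability space.\<close>

lemma W2sq_le_nn_integral:
  assumes "prob_space \<Omega>" "X \<in> borel_measurable \<Omega>" "Y \<in> borel_measurable \<Omega>"
  shows "W2sq (distr \<Omega> borel X) (distr \<Omega> borel Y) \<le> (\<integral>\<^sup>+w. ennreal ((dist (X w) (Y w))\<^sup>2) \<partial>\<Omega>)"
  unfolding W2sq_def couplings_distr(2)[OF assms, symmetric]
  by (rule INF_lower) (rule couplings_distr(1)[OF assms])

lemma prob_measD: "\<mu> \<in> prob_meas \<Longrightarrow> prob_space \<mu>" "\<mu> \<in> prob_meas \<Longrightarrow> sets \<mu> = sets borel"
  by (auto simp: prob_meas_def)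

lemma couplingsD:
  assumes "\<pi> \<in> couplings \<mu> \<nu>"
  shows "prob_space \<pi>" "sets \<pi> = sets borel" "distr \<pi> borel fst = \<mu>" "distr \<pi> borel snd = \<nu>"
    "fst \<in> borel_measurable \<pi>" "snd \<in> borel_measurable \<pi>"
proof -
  show *: "prob_space \<pi>" "sets \<pi> = sets borel" "distr \<pi> borel fst = \<mu>" "distr \<pi> borel snd = \<nu>"
    using assms by (auto simp: couplings_def)
  show "fst \<in> borel_measurable \<pi>" "snd \<in> borel_measurable \<pi>"
    by (simp_all add: measurable_cong_sets[OF *(2) refl])
qed

lemma couplings_prob_meas:
  assumes "\<pi> \<in> couplings \<mu> \<nu>"
  shows "\<mu> \<in> prob_meas" "\<nu> \<in> prob_meas"
proof -
  note p = couplingsD[OF assms]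
  show "\<mu> \<in> prob_meas" "\<nu> \<in> prob_meas"
    unfolding prob_meas_def p(3)[symmetric] p(4)[symmetric]
    using prob_space.prob_space_distr[OF p(1) p(5)] prob_space.prob_space_distr[OF p(1) p(6)] by simp_all
qed

lemma W2sq_refl:
  assumes "\<mu> \<in> prob_meas"
  shows "W2sq \<mu> \<mu> = 0"
proof -
  have m: "(\<lambda>x. x) \<in> borel_measurable \<mu>"
    by (simp add: measurable_cong_sets[OF prob_measD(2)[OF assms] refl])
  have "distr \<mu> borel (\<lambda>x. x) = \<mu>" by (rule distr_id2) (simp add: prob_measD[OF assms])
  then have "W2sq \<mu> \<mu> \<le> 0" using W2sq_le_nn_integral[OF prob_measD(1)[OF assms] m m] by simp
  then show ?thesis by simp
qed

lemma W2sq_le_commute: "W2sq \<nu> \<mu> \<le> W2sq \<mu> \<nu>"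
  unfolding W2sq_def[of \<mu> \<nu>]
proof (rule INF_greatest)
  fix \<pi> assume "\<pi> \<in> couplings \<mu> \<nu>"
  note p = couplingsD[OF this]
  have "W2sq \<nu> \<mu> \<le> (\<integral>\<^sup>+w. ennreal ((dist (snd w) (fst w))\<^sup>2) \<partial>\<pi>)"
    using W2sq_le_nn_integral[OF p(1,6,5)] by (simp only: p(3,4))
  then show "W2sq \<nu> \<mu> \<le> tcost \<pi>" by (simp add: tcost_def dist_commute)
qed

lemma W2sq_commute: "W2sq \<mu> \<nu> = W2sq \<nu> \<mu>"
  by (intro antisym W2sq_le_commute)

text \<open>Gluing without disintegration: make the outer variables conditionally independent given the
  cell of a countable partition into small cells that contains the common variable. The two copies of
  the common variable then agree up to the mesh of the partition.\<close>

lemma approximate_gluing: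
  fixes \<pi> \<pi>' :: "('a::euclidean_space \<times> 'a) measure"
  assumes \<pi>: "\<pi> \<in> couplings \<mu> \<rho>" and \<pi>': "\<pi>' \<in> couplings \<rho> \<nu>" and "0 < \<delta>"
  obtains \<Omega> where "prob_space \<Omega>" "sets \<Omega> = sets (borel :: (('a \<times> 'a) \<times> ('a \<times> 'a)) measure)"
    "\<And>g. g \<in> borel_measurable borel \<Longrightarrow> (\<integral>\<^sup>+w. g (fst w) \<partial>\<Omega>) = (\<integral>\<^sup>+p. g p \<partial>\<pi>)"
    "\<And>g. g \<in> borel_measurable borel \<Longrightarrow> (\<integral>\<^sup>+w. g (snd w) \<partial>\<Omega>) = (\<integral>\<^sup>+p. g p \<partial>\<pi>')"
    "AE w in \<Omega>. dist (snd (fst w)) (fst (snd w)) \<le> \<delta>"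
proof -
  note p = couplingsD[OF \<pi>] and p' = couplingsD[OF \<pi>']
  have [measurable_cong]: "sets \<pi> = sets borel" "sets \<pi>' = sets borel" using p p' by auto
  interpret P: prob_space \<pi> by (rule p)
  interpret P': prob_space \<pi>' by (rule p')
  interpret pair_sigma_finite \<pi> \<pi>' ..
  have \<rho>: "prob_space \<rho>" "sets \<rho> = sets borel"
    using couplings_prob_meas[OF \<pi>] prob_measD by blast+
  interpret R: prob_space \<rho> by (rule \<rho>)
  have spp: "space \<pi> = UNIV" "space \<pi>' = UNIV"
    using sets_eq_imp_space_eq[OF p(2)] sets_eq_imp_space_eq[OF p'(2)] by auto
  obtain D :: "'a set" where D: "countable D" "\<And>X. open X \<Longrightarrow> X \<noteq> {} \<Longrightarrow> \<exists>d\<in>D. d \<in> X"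
    using countable_dense_setE by blast
  have "D \<noteq> {}" using D(2)[of UNIV] by auto
  define q where "q = from_nat_into D"
  have cover: "\<exists>n. dist x (q n) < \<delta> / 2" for x
  proof -
    obtain z where z: "z \<in> D" "z \<in> ball x (\<delta> / 2)" using D(2)[of "ball x (\<delta>/2)"] \<open>0 < \<delta>\<close> by auto
    obtain n where "q n = z" using from_nat_into_surj[OF D(1) z(1)] unfolding q_def by blast
    then show ?thesis using z by auto
  qed
  \<comment> \<open>Taking the least index turns the overlapping balls of radius
    \<open>\<delta> / 2\<close> into disjoint cells.\<close>
  define cell where "cell x = (LEAST n. dist x (q n) < \<delta> / 2)" for x
  have cell: "dist x (q (cell x)) < \<delta> / 2" for x
    unfolding cell_def using cover[of x] by (rule LeastI_ex)
  have cellm[measurable]: "cell \<in> measurable borel (count_space UNIV)"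
    unfolding cell_def[abs_def] by measurable
  define Q where "Q n = cell -` {n}" for n
  have Q[measurable]: "Q n \<in> sets borel" for n
    unfolding Q_def using measurable_sets[OF cellm, of "{n}"] by simp
  \<comment> \<open>A null cell gets weight infinity, as \<open>1 / 0 = \<infinity>\<close> in
    \<open>ennreal\<close>; \<open>AE1\<close> and \<open>AE2\<close> discard such cells.\<close>
  define wt where "wt n = 1 / emeasure \<rho> (Q n)" for n
  define cA where "cA w = cell (snd (fst w))" for w :: "('a \<times> 'a) \<times> ('a \<times> 'a)"
  define cB where "cB w = cell (fst (snd w))" for w :: "('a \<times> 'a) \<times> ('a \<times> 'a)"
  have cAB: "cA \<in> measurable (\<pi> \<Otimes>\<^sub>M \<pi>') (count_space UNIV)"
    "cB \<in> measurable (\<pi> \<Otimes>\<^sub>M \<pi>') (count_space UNIV)"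
    unfolding cA_def[abs_def] cB_def[abs_def]
    by (rule measurable_compose[OF measurable_compose[OF measurable_fst p(6)] cellm]
        measurable_compose[OF measurable_compose[OF measurable_snd p'(5)] cellm])+
  \<comment> \<open>Density, relative to the product, of the law under which the two pairs are
    conditionally independent given a common cell.\<close>
  define f where "f w = (if cA w = cB w then wt (cA w) else 0)" for w
  have "(\<lambda>w. (cA w, cB w)) \<in> measurable (\<pi> \<Otimes>\<^sub>M \<pi>') (count_space UNIV)"
    using measurable_Pair[OF cAB] by (simp add: pair_measure_countable)
  from measurable_compose[OF this, of "\<lambda>(i, j). if i = j then wt i else 0" borel]
  have fm[measurable]: "f \<in> borel_measurable (\<pi> \<Otimes>\<^sub>M \<pi>')"
    by (simp add: f_def[abs_def])
  have Q1: "emeasure \<pi>' {v. cell (fst v) = n} = emeasure \<rho> (Q n)" for n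
    using emeasure_distr[OF p'(5) Q[of n]] by (simp add: p'(3) Q_def spp vimage_def)
  have Q2: "emeasure \<pi> {v. cell (snd v) = n} = emeasure \<rho> (Q n)" for n
    using emeasure_distr[OF p(6) Q[of n]] by (simp add: p(4) Q_def spp vimage_def)
  have "AE x in \<rho>. \<forall>n. x \<in> Q n \<longrightarrow> emeasure \<rho> (Q n) \<noteq> 0"
  proof (subst AE_all_countable, rule allI)
    fix n
    show "AE x in \<rho>. x \<in> Q n \<longrightarrow> emeasure \<rho> (Q n) \<noteq> 0"
    proof (cases "emeasure \<rho> (Q n) = 0")
      case True
      then have "Q n \<in> null_sets \<rho>" using Q \<rho>(2) by auto
      then show ?thesis by (rule AE_I') auto
    qed simp
  qed
  then have AEr: "AE x in \<rho>. emeasure \<rho> (Q (cell x)) \<noteq> 0"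
    by (rule eventually_mono) (auto simp: Q_def)
  have AE1: "AE v in \<pi>. emeasure \<rho> (Q (cell (snd v))) \<noteq> 0"
    using AEr unfolding p(4)[symmetric] by (subst (asm) AE_distr_iff) (auto simp: p(6))
  have AE2: "AE v in \<pi>'. emeasure \<rho> (Q (cell (fst v))) \<noteq> 0"
    using AEr unfolding p'(3)[symmetric] by (subst (asm) AE_distr_iff) (auto simp: p'(5))
  have quot: "1 / x * x = 1" if "x \<noteq> 0" "x \<noteq> \<infinity>" for x :: ennreal
    using that by (simp add: ennreal_divide_times ennreal_divide_self top.not_eq_extremum)
  \<comment> \<open>Integrating out one pair yields the mass of the matching cell, which cancels the
    weight. So the density leaves both marginals unchanged.\<close>
  have inner1: "(\<integral>\<^sup>+v'. f (v, v') \<partial>\<pi>') = 1" if "emeasure \<rho> (Q (cell (snd v))) \<noteq> 0" for v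
  proof -
    have "(\<integral>\<^sup>+v'. f (v, v') \<partial>\<pi>') = (\<integral>\<^sup>+v'. 1 / emeasure \<rho> (Q (cell (snd v))) * indicator {v'. cell (fst v') = cell (snd v)} v' \<partial>\<pi>')"
      by (intro nn_integral_cong) (auto simp: f_def cA_def cB_def wt_def indicator_def)
    also have "\<dots> = 1 / emeasure \<rho> (Q (cell (snd v))) * emeasure \<rho> (Q (cell (snd v)))"
      by (subst nn_integral_cmult_indicator) (auto simp: Q1)
    also have "\<dots> = 1" using that by (intro quot) auto
    finally show ?thesis .
  qed
  have inner2: "(\<integral>\<^sup>+v. f (v, v') \<partial>\<pi>) = 1" if "emeasure \<rho> (Q (cell (fst v'))) \<noteq> 0" for v'
  proof -
    have "(\<integral>\<^sup>+v. f (v, v') \<partial>\<pi>) = (\<integral>\<^sup>+v. 1 / emeasure \<rho> (Q (cell (fst v'))) * indicator {v. cell (snd v) = cell (fst v')} v \<partial>\<pi>)"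
      by (intro nn_integral_cong) (auto simp: f_def cA_def cB_def wt_def indicator_def)
    also have "\<dots> = 1 / emeasure \<rho> (Q (cell (fst v'))) * emeasure \<rho> (Q (cell (fst v')))"
      by (subst nn_integral_cmult_indicator) (auto simp: Q2)
    also have "\<dots> = 1" using that by (intro quot) auto
    finally show ?thesis .
  qed
  define \<Omega> where "\<Omega> = density (\<pi> \<Otimes>\<^sub>M \<pi>') f"
  have m1: "(\<integral>\<^sup>+w. g (fst w) \<partial>\<Omega>) = (\<integral>\<^sup>+v. g v \<partial>\<pi>)" if g[measurable]: "g \<in> borel_measurable borel" for g
  proof -
    have "(\<integral>\<^sup>+w. g (fst w) \<partial>\<Omega>) = (\<integral>\<^sup>+w. f w * g (fst w) \<partial>(\<pi> \<Otimes>\<^sub>M \<pi>'))"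
      unfolding \<Omega>_def by (subst nn_integral_density) auto
    also have "\<dots> = (\<integral>\<^sup>+v. \<integral>\<^sup>+v'. f (v, v') * g v \<partial>\<pi>' \<partial>\<pi>)"
      by (subst P'.nn_integral_fst[symmetric]) auto
    also have "\<dots> = (\<integral>\<^sup>+v. (\<integral>\<^sup>+v'. f (v, v') \<partial>\<pi>') * g v \<partial>\<pi>)"
      by (intro nn_integral_cong nn_integral_multc) auto
    also have "\<dots> = (\<integral>\<^sup>+v. g v \<partial>\<pi>)"
      by (intro nn_integral_cong_AE eventually_mono[OF AE1]) (simp add: inner1)
    finally show ?thesis .
  qed
  have m2: "(\<integral>\<^sup>+w. g (snd w) \<partial>\<Omega>) = (\<integral>\<^sup>+v. g v \<partial>\<pi>')" if g[measurable]: "g \<in> borel_measurable borel" for g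
  proof -
    have "(\<integral>\<^sup>+w. g (snd w) \<partial>\<Omega>) = (\<integral>\<^sup>+w. f w * g (snd w) \<partial>(\<pi> \<Otimes>\<^sub>M \<pi>'))"
      unfolding \<Omega>_def by (subst nn_integral_density) auto
    also have "\<dots> = (\<integral>\<^sup>+v'. \<integral>\<^sup>+v. f (v, v') * g v' \<partial>\<pi> \<partial>\<pi>')"
      by (subst nn_integral_snd[symmetric]) auto
    also have "\<dots> = (\<integral>\<^sup>+v'. (\<integral>\<^sup>+v. f (v, v') \<partial>\<pi>) * g v' \<partial>\<pi>')"
      by (intro nn_integral_cong nn_integral_multc) auto
    also have "\<dots> = (\<integral>\<^sup>+v'. g v' \<partial>\<pi>')"
      by (intro nn_integral_cong_AE eventually_mono[OF AE2]) (simp add: inner2)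
    finally show ?thesis .
  qed
  have "prob_space \<Omega>"
  proof
    have "emeasure \<Omega> (space \<Omega>) = (\<integral>\<^sup>+w. 1 \<partial>\<Omega>)" by simp
    also have "\<dots> = 1" using m1[of "\<lambda>_. 1"] P.emeasure_space_1 by simp
    finally show "emeasure \<Omega> (space \<Omega>) = 1" .
  qed
  moreover have "sets \<Omega> = sets (borel :: (('a \<times> 'a) \<times> ('a \<times> 'a)) measure)"
  proof -
    have "sets \<Omega> = sets (\<pi> \<Otimes>\<^sub>M \<pi>')" by (simp add: \<Omega>_def)
    also have "\<dots> = sets (borel \<Otimes>\<^sub>M borel :: (('a \<times> 'a) \<times> ('a \<times> 'a)) measure)"
      by (rule sets_pair_measure_cong) (use p p' in auto)
    finally show ?thesis by (simp only: borel_prod)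
  qed
  moreover have "AE w in \<Omega>. dist (snd (fst w)) (fst (snd w)) \<le> \<delta>"
    unfolding \<Omega>_def
  proof (subst AE_density[OF fm], rule AE_I2, rule impI)
    fix w assume "0 < f w"
    then have "cell (snd (fst w)) = cell (fst (snd w))" by (auto simp: f_def cA_def cB_def split: if_splits)
    then show "dist (snd (fst w)) (fst (snd w)) \<le> \<delta>"
      using cell[of "snd (fst w)"] cell[of "fst (snd w)"]
        dist_triangle2[of "snd (fst w)" "fst (snd w)" "q (cell (fst (snd w)))"] by simp
  qed
  ultimately show thesis using that m1 m2 by blast
qed

text \<open>Young's inequality with a free weight. It is linear in the squares and can be integrated
  termwise; \<open>le_power2_sum_of_weighted\<close> afterwards recovers what Minkowski's inequality
  would give.\<close>

lemma power2_sum_le_weighted: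
  fixes a b s :: real
  assumes "0 < s"
  shows "(a + b)\<^sup>2 \<le> (1 + s) * a\<^sup>2 + (1 + 1 / s) * b\<^sup>2"
proof -
  have "0 \<le> (s * a - b)\<^sup>2 / s" using assms by simp
  also have "\<dots> = s * a\<^sup>2 - 2 * a * b + b\<^sup>2 / s"
    using assms by (simp add: power2_eq_square field_simps)
  finally show ?thesis by (simp add: power2_eq_square algebra_simps)
qed

lemma le_power2_sum_of_weighted:
  fixes a b w :: real
  assumes "0 \<le> a" "0 \<le> b" and le: "\<And>s. 0 < s \<Longrightarrow> w \<le> (1 + s) * a\<^sup>2 + (1 + 1 / s) * b\<^sup>2"
  shows "w \<le> (a + b)\<^sup>2"
proof -
  have *: "w \<le> (a + b + 2 * \<epsilon>)\<^sup>2" if e: "0 < \<epsilon>" for \<epsilon>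
  proof -
    \<comment> \<open>The optimal weight is \<open>b / a\<close>; the shift by \<epsilon> makes it
      well defined and positive.\<close>
    define A B where "A = a + \<epsilon>" and "B = b + \<epsilon>"
    have AB: "0 < A" "0 < B" "a \<le> A" "b \<le> B" using assms e by (auto simp: A_def B_def)
    have "w \<le> (1 + B / A) * a\<^sup>2 + (1 + 1 / (B / A)) * b\<^sup>2" using AB by (intro le) auto
    also have "\<dots> \<le> (1 + B / A) * A\<^sup>2 + (1 + 1 / (B / A)) * B\<^sup>2"
      using AB assms by (intro add_mono mult_left_mono power_mono) auto
    also have "\<dots> = (A + B)\<^sup>2" using AB by (simp add: power2_eq_square field_simps)
    finally show ?thesis by (simp add: A_def B_def algebra_simps)
  qed
  have "((\<lambda>\<epsilon>. (a + b + 2 * \<epsilon>)\<^sup>2) \<longlongrightarrow> (a + b + 2 * 0)\<^sup>2) (at_right 0)"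
    by (intro tendsto_intros)
  moreover have "eventually (\<lambda>\<epsilon>. w \<le> (a + b + 2 * \<epsilon>)\<^sup>2) (at_right (0::real))"
    unfolding eventually_at_right_field using * by (intro exI[of _ 1]) auto
  ultimately show ?thesis
    using tendsto_lowerbound[where F = "at_right (0::real)"] by fastforce
qed

text \<open>The path through the two nearby copies of the middle variable has three legs. Young's
  inequality with weight \<open>\<delta>\<close> absorbs the short leg into the first one, and with
  weight \<open>s\<close> it joins the two long ones. The cost of the short leg, \<open>(1 + 1 /
  \<delta>) * \<delta>\<^sup>2 = \<delta>\<^sup>2 + \<delta>\<close>, still tends to 0.\<close>

lemma W2sq_le_of_couplings:
  fixes \<pi> \<pi>' :: "('a::euclidean_space \<times> 'a) measure"
  assumes \<pi>: "\<pi> \<in> couplings \<mu> \<rho>" and \<pi>': "\<pi>' \<in> couplings \<rho> \<nu>" and s: "0 < s"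
    and fin: "tcost \<pi> = ennreal A" "tcost \<pi>' = ennreal B" "0 \<le> A" "0 \<le> B"
  shows "W2sq \<mu> \<nu> \<le> ennreal ((1 + s) * A + (1 + 1 / s) * B)"
proof -
  note p = couplingsD[OF \<pi>] and p' = couplingsD[OF \<pi>']
  have bound0: "W2sq \<mu> \<nu> \<le> ennreal ((1 + s) * ((1 + \<delta>) * A + (1 + 1 / \<delta>) * \<delta>\<^sup>2) + (1 + 1 / s) * B)" if d: "0 < \<delta>" for \<delta>
  proof -
    obtain \<Omega> where O: "prob_space \<Omega>" "sets \<Omega> = sets (borel :: (('a \<times> 'a) \<times> ('a \<times> 'a)) measure)"
      and m1: "\<And>g. g \<in> borel_measurable borel \<Longrightarrow> (\<integral>\<^sup>+w. g (fst w) \<partial>\<Omega>) = (\<integral>\<^sup>+p. g p \<partial>\<pi>)"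
      and m2: "\<And>g. g \<in> borel_measurable borel \<Longrightarrow> (\<integral>\<^sup>+w. g (snd w) \<partial>\<Omega>) = (\<integral>\<^sup>+p. g p \<partial>\<pi>')"
      and near: "AE w in \<Omega>. dist (snd (fst w)) (fst (snd w)) \<le> \<delta>"
      by (rule approximate_gluing[OF \<pi> \<pi>' d]) blast
    interpret prob_space \<Omega> by (rule O)
    have [measurable_cong]: "sets \<Omega> = sets borel" by (rule O)
    have f1[measurable]: "fst \<in> borel_measurable \<Omega>" "snd \<in> borel_measurable \<Omega>"
      by (simp_all add: measurable_cong_sets[OF O(2) refl])
    have x[measurable]: "(\<lambda>w. fst (fst w)) \<in> borel_measurable \<Omega>" "(\<lambda>w. snd (snd w)) \<in> borel_measurable \<Omega>"
      by (auto intro: measurable_compose[OF f1(1) borel_measurable_fst_snd(1)]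
          measurable_compose[OF f1(2) borel_measurable_fst_snd(2)])
    have marg1: "distr \<Omega> borel (\<lambda>w. fst (fst w)) = \<mu>"
    proof (rule measure_eqI)
      fix S assume "S \<in> sets (distr \<Omega> borel (\<lambda>w. fst (fst w)))"
      then have S[measurable]: "S \<in> sets borel" by simp
      have "emeasure (distr \<Omega> borel (\<lambda>w. fst (fst w))) S = (\<integral>\<^sup>+w. indicator S (fst (fst w)) \<partial>\<Omega>)"
        by (rule emeasure_distr_eq_nn_integral) (rule x S)+
      also have "\<dots> = (\<integral>\<^sup>+v. indicator S (fst v) \<partial>\<pi>)" by (rule m1[of "\<lambda>v. indicator S (fst v)"]) measurable
      also have "\<dots> = emeasure (distr \<pi> borel fst) S"
        by (rule emeasure_distr_eq_nn_integral[symmetric]) (rule p S)+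
      finally show "emeasure (distr \<Omega> borel (\<lambda>w. fst (fst w))) S = emeasure \<mu> S" by (simp add: p)
    qed (use prob_measD(2)[OF couplings_prob_meas(1)[OF \<pi>]] in simp)
    have marg2: "distr \<Omega> borel (\<lambda>w. snd (snd w)) = \<nu>"
    proof (rule measure_eqI)
      fix S assume "S \<in> sets (distr \<Omega> borel (\<lambda>w. snd (snd w)))"
      then have S[measurable]: "S \<in> sets borel" by simp
      have "emeasure (distr \<Omega> borel (\<lambda>w. snd (snd w))) S = (\<integral>\<^sup>+w. indicator S (snd (snd w)) \<partial>\<Omega>)"
        by (rule emeasure_distr_eq_nn_integral) (rule x S)+
      also have "\<dots> = (\<integral>\<^sup>+v. indicator S (snd v) \<partial>\<pi>')" by (rule m2[of "\<lambda>v. indicator S (snd v)"]) measurable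
      also have "\<dots> = emeasure (distr \<pi>' borel snd) S"
        by (rule emeasure_distr_eq_nn_integral[symmetric]) (rule p' S)+
      finally show "emeasure (distr \<Omega> borel (\<lambda>w. snd (snd w))) S = emeasure \<nu> S" by (simp add: p')
    qed (use prob_measD(2)[OF couplings_prob_meas(2)[OF \<pi>']] in simp)
    define cost where "cost v = ennreal ((dist (fst v) (snd v))\<^sup>2)" for v :: "'a \<times> 'a"
    have cost[measurable]: "cost \<in> borel_measurable borel" unfolding cost_def[abs_def] by measurable
    have c1[measurable]: "(\<lambda>w. cost (fst w)) \<in> borel_measurable \<Omega>" "(\<lambda>w. cost (snd w)) \<in> borel_measurable \<Omega>"
      by (auto intro: measurable_compose[OF f1(1) cost] measurable_compose[OF f1(2) cost])
    have "W2sq \<mu> \<nu> \<le> (\<integral>\<^sup>+w. ennreal ((dist (fst (fst w)) (snd (snd w)))\<^sup>2) \<partial>\<Omega>)"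
      using W2sq_le_nn_integral[OF O(1) x] by (simp only: marg1 marg2)
    also have "\<dots> \<le> (\<integral>\<^sup>+w. ennreal ((1 + s) * (1 + \<delta>)) * cost (fst w) + ennreal (1 + 1 / s) * cost (snd w)
        + ennreal ((1 + s) * ((1 + 1 / \<delta>) * \<delta>\<^sup>2)) \<partial>\<Omega>)"
    proof (intro nn_integral_mono_AE eventually_mono[OF near])
      fix w :: "('a \<times> 'a) \<times> ('a \<times> 'a)" assume n: "dist (snd (fst w)) (fst (snd w)) \<le> \<delta>"
      define a b where "a = dist (fst (fst w)) (snd (fst w))" and "b = dist (fst (snd w)) (snd (snd w))"
      have "dist (fst (fst w)) (snd (snd w)) \<le> (a + \<delta>) + b"
        using dist_triangle[of "fst (fst w)" "snd (snd w)" "snd (fst w)"]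
          dist_triangle[of "snd (fst w)" "snd (snd w)" "fst (snd w)"] n by (simp add: a_def b_def)
      then have "(dist (fst (fst w)) (snd (snd w)))\<^sup>2 \<le> ((a + \<delta>) + b)\<^sup>2" by (intro power_mono) auto
      also have "\<dots> \<le> (1 + s) * (a + \<delta>)\<^sup>2 + (1 + 1 / s) * b\<^sup>2" by (rule power2_sum_le_weighted[OF s])
      also have "\<dots> \<le> (1 + s) * ((1 + \<delta>) * a\<^sup>2 + (1 + 1 / \<delta>) * \<delta>\<^sup>2) + (1 + 1 / s) * b\<^sup>2"
        using s by (intro add_right_mono mult_left_mono power2_sum_le_weighted[OF d]) auto
      also have "\<dots> = (1 + s) * (1 + \<delta>) * a\<^sup>2 + (1 + 1 / s) * b\<^sup>2 + (1 + s) * ((1 + 1 / \<delta>) * \<delta>\<^sup>2)"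
        by (simp add: algebra_simps)
      finally have "ennreal ((dist (fst (fst w)) (snd (snd w)))\<^sup>2)
        \<le> ennreal ((1 + s) * (1 + \<delta>) * a\<^sup>2 + (1 + 1 / s) * b\<^sup>2 + (1 + s) * ((1 + 1 / \<delta>) * \<delta>\<^sup>2))"
        by (rule ennreal_leI)
      also have "\<dots> = ennreal ((1 + s) * (1 + \<delta>)) * cost (fst w) + ennreal (1 + 1 / s) * cost (snd w)
        + ennreal ((1 + s) * ((1 + 1 / \<delta>) * \<delta>\<^sup>2))"
        using s d by (simp add: cost_def a_def b_def ennreal_plus ennreal_mult' del: ennreal_plus[symmetric])
      finally show "ennreal ((dist (fst (fst w)) (snd (snd w)))\<^sup>2)
        \<le> ennreal ((1 + s) * (1 + \<delta>)) * cost (fst w) + ennreal (1 + 1 / s) * cost (snd w)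
        + ennreal ((1 + s) * ((1 + 1 / \<delta>) * \<delta>\<^sup>2))" .
    qed
    also have "\<dots> = ennreal ((1 + s) * (1 + \<delta>)) * (\<integral>\<^sup>+w. cost (fst w) \<partial>\<Omega>)
        + ennreal (1 + 1 / s) * (\<integral>\<^sup>+w. cost (snd w) \<partial>\<Omega>) + ennreal ((1 + s) * ((1 + 1 / \<delta>) * \<delta>\<^sup>2))"
      by (simp add: nn_integral_add nn_integral_cmult emeasure_space_1)
    also have "\<dots> = ennreal ((1 + s) * (1 + \<delta>)) * ennreal A + ennreal (1 + 1 / s) * ennreal B
        + ennreal ((1 + s) * ((1 + 1 / \<delta>) * \<delta>\<^sup>2))"
      using m1[OF cost] m2[OF cost] fin(1,2) by (simp add: tcost_def cost_def)
    also have "\<dots> = ennreal ((1 + s) * (1 + \<delta>) * A + (1 + 1 / s) * B + (1 + s) * ((1 + 1 / \<delta>) * \<delta>\<^sup>2))"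
      using s d fin by (simp add: ennreal_plus ennreal_mult')
    also have "(1 + s) * (1 + \<delta>) * A + (1 + 1 / s) * B + (1 + s) * ((1 + 1 / \<delta>) * \<delta>\<^sup>2)
       = (1 + s) * ((1 + \<delta>) * A + (1 + 1 / \<delta>) * \<delta>\<^sup>2) + (1 + 1 / s) * B" by (simp add: algebra_simps)
    finally show ?thesis .
  qed
  have bound: "W2sq \<mu> \<nu> \<le> ennreal ((1 + s) * ((1 + \<delta>) * A + \<delta>\<^sup>2 + \<delta>) + (1 + 1 / s) * B)" if "0 < \<delta>" for \<delta>
  proof -
    have "(1 + 1 / \<delta>) * \<delta>\<^sup>2 = \<delta>\<^sup>2 + \<delta>" using that by (simp add: power2_eq_square field_simps)
    then show ?thesis using bound0[OF that] by (simp add: add.assoc)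
  qed
  have "((\<lambda>\<delta>. ennreal ((1 + s) * ((1 + \<delta>) * A + \<delta>\<^sup>2 + \<delta>) + (1 + 1 / s) * B))
     \<longlongrightarrow> ennreal ((1 + s) * ((1 + 0) * A + 0\<^sup>2 + 0) + (1 + 1 / s) * B)) (at_right 0)"
    by (intro tendsto_intros)
  moreover have "eventually (\<lambda>\<delta>. W2sq \<mu> \<nu> \<le> ennreal ((1 + s) * ((1 + \<delta>) * A + \<delta>\<^sup>2 + \<delta>) + (1 + 1 / s) * B)) (at_right 0)"
    unfolding eventually_at_right_field using bound by (intro exI[of _ 1]) auto
  ultimately show ?thesis
    using tendsto_lowerbound[where F = "at_right (0::real)"] by fastforce
qed

text \<open>\<open>enn2real\<close> sends infinity to 0, so finiteness has to accompany every use of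
  the real-valued \<open>W2\<close>.\<close>

lemma W2sq_eq_W2: "W2sq \<mu> \<nu> < \<infinity> \<Longrightarrow> W2sq \<mu> \<nu> = ennreal ((W2 \<mu> \<nu>)\<^sup>2)"
  by (simp add: W2_def)

lemma W2_nonneg: "0 \<le> W2 \<mu> \<nu>"
  by (simp add: W2_def)

lemma W2_le_iff:
  assumes "W2sq \<mu> \<nu> < \<infinity>" "0 \<le> c"
  shows "W2 \<mu> \<nu> \<le> c \<longleftrightarrow> W2sq \<mu> \<nu> \<le> ennreal (c\<^sup>2)"
  unfolding W2sq_eq_W2[OF assms(1)] using assms(2) W2_nonneg[of \<mu> \<nu>]
  by (subst ennreal_le_iff) auto

lemma W2_commute: "W2 \<mu> \<nu> = W2 \<nu> \<mu>"
  by (simp add: W2_def W2sq_commute[of \<mu> \<nu>])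

lemma coupling_below:
  assumes "W2sq \<mu> \<nu> < ennreal c"
  obtains \<pi> C where "\<pi> \<in> couplings \<mu> \<nu>" "tcost \<pi> = ennreal C" "0 \<le> C" "C < c"
proof -
  obtain \<pi> where p: "\<pi> \<in> couplings \<mu> \<nu>" "tcost \<pi> < ennreal c"
    using assms unfolding W2sq_def by (auto simp: INF_less_iff)
  then obtain C where C: "tcost \<pi> = ennreal C" "0 \<le> C" by (cases "tcost \<pi>") auto
  with p show thesis using that by (auto simp: ennreal_less_iff)
qed

text \<open>Couplings within \<epsilon> of the infimum are combined. First \<epsilon> tends to 0 at
  fixed \<open>s\<close>, then varying \<open>s\<close> restores the square of the sum.\<close>

lemma W2_triangle:
  assumes "W2sq \<mu> \<rho> < \<infinity>" "W2sq \<rho> \<nu> < \<infinity>"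
  shows "W2sq \<mu> \<nu> < \<infinity>" "W2 \<mu> \<nu> \<le> W2 \<mu> \<rho> + W2 \<rho> \<nu>"
proof -
  define a b where "a = W2 \<mu> \<rho>" and "b = W2 \<rho> \<nu>"
  have ab: "0 \<le> a" "0 \<le> b" by (auto simp: a_def b_def W2_nonneg)
  have le: "W2sq \<mu> \<nu> \<le> ennreal ((1 + s) * a\<^sup>2 + (1 + 1 / s) * b\<^sup>2)" if s: "0 < s" for s
  proof -
    have bnd: "W2sq \<mu> \<nu> \<le> ennreal ((1 + s) * (a\<^sup>2 + \<epsilon>) + (1 + 1 / s) * (b\<^sup>2 + \<epsilon>))" if e: "0 < \<epsilon>" for \<epsilon>
    proof -
      have "W2sq \<mu> \<rho> < ennreal (a\<^sup>2 + \<epsilon>)" "W2sq \<rho> \<nu> < ennreal (b\<^sup>2 + \<epsilon>)"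
        using e by (simp_all add: W2sq_eq_W2[OF assms(1)] W2sq_eq_W2[OF assms(2)] a_def b_def ennreal_less_iff)
      then obtain \<pi> A \<pi>' B where c: "\<pi> \<in> couplings \<mu> \<rho>" "tcost \<pi> = ennreal A" "0 \<le> A" "A < a\<^sup>2 + \<epsilon>"
          "\<pi>' \<in> couplings \<rho> \<nu>" "tcost \<pi>' = ennreal B" "0 \<le> B" "B < b\<^sup>2 + \<epsilon>"
        by (metis coupling_below)
      have "W2sq \<mu> \<nu> \<le> ennreal ((1 + s) * A + (1 + 1 / s) * B)"
        by (rule W2sq_le_of_couplings) (use c s in auto)
      also have "\<dots> \<le> ennreal ((1 + s) * (a\<^sup>2 + \<epsilon>) + (1 + 1 / s) * (b\<^sup>2 + \<epsilon>))"
        using c s by (intro ennreal_leI add_mono mult_left_mono) auto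
      finally show ?thesis .
    qed
    have "((\<lambda>\<epsilon>. ennreal ((1 + s) * (a\<^sup>2 + \<epsilon>) + (1 + 1 / s) * (b\<^sup>2 + \<epsilon>)))
       \<longlongrightarrow> ennreal ((1 + s) * (a\<^sup>2 + 0) + (1 + 1 / s) * (b\<^sup>2 + 0))) (at_right 0)"
      by (intro tendsto_intros)
    moreover have "eventually (\<lambda>\<epsilon>. W2sq \<mu> \<nu> \<le> ennreal ((1 + s) * (a\<^sup>2 + \<epsilon>) + (1 + 1 / s) * (b\<^sup>2 + \<epsilon>))) (at_right 0)"
      unfolding eventually_at_right_field using bnd by (intro exI[of _ 1]) auto
    ultimately show ?thesis
      using tendsto_lowerbound[where F = "at_right (0::real)"] by fastforce
  qed
  show fin: "W2sq \<mu> \<nu> < \<infinity>" using le[of 1] by (simp add: le_less_trans)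
  have "(W2 \<mu> \<nu>)\<^sup>2 \<le> (1 + s) * a\<^sup>2 + (1 + 1 / s) * b\<^sup>2" if "0 < s" for s
    using le[OF that] unfolding W2sq_eq_W2[OF fin] by (subst (asm) ennreal_le_iff) (use that in auto)
  then have "(W2 \<mu> \<nu>)\<^sup>2 \<le> (a + b)\<^sup>2" by (intro le_power2_sum_of_weighted ab) auto
  then show "W2 \<mu> \<nu> \<le> W2 \<mu> \<rho> + W2 \<rho> \<nu>" unfolding a_def b_def
    by (rule power2_le_imp_le) (simp add: W2_nonneg)
qed

section \<open>Compactness of couplings and completeness of the Wasserstein distance\<close>

lemma narrowly_converges_unique:
  assumes "narrowly_converges M L" "narrowly_converges M K" "prob_space L" "sets L = sets borel"
    "prob_space K" "sets K = sets borel"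
  shows "L = K"
proof (rule measure_eq_of_continuous_integrals[OF assms(3-6)])
  fix f :: "'a \<Rightarrow> real" and B assume "continuous_on UNIV f" "\<And>x. \<bar>f x\<bar> \<le> B"
  then have "(\<lambda>n. integral\<^sup>L (M n) f) \<longlonglongrightarrow> integral\<^sup>L L f" "(\<lambda>n. integral\<^sup>L (M n) f) \<longlonglongrightarrow> integral\<^sup>L K f"
    using assms(1,2) unfolding narrowly_converges_def by blast+
  then show "integral\<^sup>L L f = integral\<^sup>L K f" by (rule LIMSEQ_unique)
qed

lemma narrowly_converges_subseq:
  assumes "narrowly_converges M L" "strict_mono r"
  shows "narrowly_converges (M \<circ> r) L"
  unfolding narrowly_converges_def
proof (intro allI impI)
  fix f :: "'a \<Rightarrow> real" and B assume "continuous_on UNIV f" "\<forall>x. \<bar>f x\<bar> \<le> B"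
  then have "(\<lambda>n. integral\<^sup>L (M n) f) \<longlonglongrightarrow> integral\<^sup>L L f"
    using assms(1) unfolding narrowly_converges_def by blast
  from LIMSEQ_subseq_LIMSEQ[OF this assms(2)]
  show "(\<lambda>n. integral\<^sup>L ((M \<circ> r) n) f) \<longlonglongrightarrow> integral\<^sup>L L f" by (simp add: comp_def)
qed

lemma narrowly_converges_distr:
  fixes X :: "'b::euclidean_space \<Rightarrow> 'c::euclidean_space"
  assumes conv: "narrowly_converges M L" and X: "continuous_on UNIV X"
    and sets: "\<And>n. sets (M n) = sets borel" "sets L = sets borel"
  shows "narrowly_converges (\<lambda>n. distr (M n) borel X) (distr L borel X)"
  unfolding narrowly_converges_def
proof (intro allI impI)
  fix f :: "'c \<Rightarrow> real" and B assume f: "continuous_on UNIV f" "\<forall>x. \<bar>f x\<bar> \<le> B"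
  have Xm: "X \<in> borel_measurable borel" and fm: "f \<in> borel_measurable borel"
    using X f(1) by (auto intro: borel_measurable_continuous_onI)
  have Xm': "X \<in> borel_measurable (M n)" "X \<in> borel_measurable L" for n
    using Xm by (simp_all add: measurable_cong_sets[OF sets(1) refl] measurable_cong_sets[OF sets(2) refl])
  have "continuous_on UNIV (\<lambda>x. f (X x))" using continuous_on_compose2[OF f(1) X] by simp
  then have "(\<lambda>n. integral\<^sup>L (M n) (\<lambda>x. f (X x))) \<longlonglongrightarrow> integral\<^sup>L L (\<lambda>x. f (X x))"
    using conv f(2) unfolding narrowly_converges_def by blast
  then show "(\<lambda>n. integral\<^sup>L (distr (M n) borel X) f) \<longlonglongrightarrow> integral\<^sup>L (distr L borel X) f"
    by (simp add: integral_distr[OF Xm'(1) fm] integral_distr[OF Xm'(2) fm])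
qed

lemma prob_meas_tail:
  fixes \<mu> :: "'a::euclidean_space measure"
  assumes "\<mu> \<in> prob_meas" "0 < \<epsilon>"
  obtains R where "0 < R" "measure \<mu> {x. R < norm x} < \<epsilon>"
proof -
  interpret prob_space \<mu> by (rule prob_measD[OF assms(1)])
  have [measurable_cong]: "sets \<mu> = sets borel" by (rule prob_measD[OF assms(1)])
  have sets: "{x. r < norm x} \<in> sets \<mu>" for r
    unfolding prob_measD(2)[OF assms(1)] by measurable
  have "(\<lambda>n. measure \<mu> {x. real n < norm x}) \<longlonglongrightarrow> measure \<mu> (\<Inter>n. {x. real n < norm x})"
    by (rule finite_Lim_measure_decseq) (use sets in \<open>auto simp: decseq_def\<close>)
  also have "(\<Inter>n. {x::'a. real n < norm x}) = {}"
  proof -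
    have "\<exists>n. \<not> real n < norm x" for x :: 'a
      using reals_Archimedean2[of "norm x"] less_asym by blast
    then show ?thesis by auto
  qed
  finally have "(\<lambda>n. measure \<mu> {x. real n < norm x}) \<longlonglongrightarrow> 0" by simp
  then have "eventually (\<lambda>n. measure \<mu> {x. real n < norm x} < \<epsilon> \<and> 0 < n) sequentially"
    by (intro eventually_conj order_tendstoD eventually_gt_at_top) (use assms in auto)
  then obtain n :: nat where "measure \<mu> {x. real n < norm x} < \<epsilon>" "0 < n"
    using eventually_happens'[OF sequentially_bot] by blast
  then show thesis by (intro that[of "real n"]) auto
qed

text \<open>The fixed first marginal is tight by itself; the cost bound and Chebyshev's inequality
  pass this on to the second coordinate.\<close>

lemma couplings_tight:
  fixes \<pi> :: "nat \<Rightarrow> ('a::euclidean_space \<times> 'a) measure"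
  assumes \<pi>: "\<And>n. \<pi> n \<in> couplings \<mu> (\<nu> n)" and B: "\<And>n. tcost (\<pi> n) \<le> ennreal B" "0 \<le> B" and "0 < \<epsilon>"
  shows "\<exists>R. \<forall>n. measure (\<pi> n) {x. R < norm x} < \<epsilon>"
proof -
  note p = couplingsD[OF \<pi>]
  obtain r where r: "0 < r" "measure \<mu> {x. r < norm x} < \<epsilon> / 2"
    using prob_meas_tail[OF couplings_prob_meas(1)[OF \<pi>], of "\<epsilon>/2"] \<open>0 < \<epsilon>\<close> by auto
  \<comment> \<open>Brings Chebyshev's bound \<open>B / K\<^sup>2\<close> below
    \<open>\<epsilon> / 2\<close>; \<open>B + 1\<close> instead of \<open>B\<close> keeps
    \<open>K\<close> positive for \<open>B = 0\<close>.\<close>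
  define K where "K = sqrt (2 * (B + 1) / \<epsilon>)"
  have "B / K\<^sup>2 = (\<epsilon> / 2) * (B / (B + 1))"
    unfolding K_def using B(2) \<open>0 < \<epsilon>\<close> by (simp add: field_simps)
  also have "\<dots> < \<epsilon> / 2 * 1" using B(2) \<open>0 < \<epsilon>\<close> by (intro mult_strict_left_mono) auto
  finally have K: "0 < K" "B / K\<^sup>2 < \<epsilon> / 2" unfolding K_def using B(2) \<open>0 < \<epsilon>\<close> by auto
  have "measure (\<pi> n) {v. 2 * r + K < norm v} < \<epsilon>" for n
  proof -
    interpret prob_space "\<pi> n" by (rule p)
    have sp: "space (\<pi> n) = UNIV" using sets_eq_imp_space_eq[OF p(2)] by simp
    have S1: "{v. r < norm (fst v)} \<in> sets (\<pi> n)" unfolding p(2) by measurable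
    have S2: "{v. K \<le> dist (fst v) (snd v)} \<in> sets (\<pi> n)" unfolding p(2) by measurable
    have "measure (\<pi> n) {v. 2 * r + K < norm v} \<le> measure (\<pi> n) ({v. r < norm (fst v)} \<union> {v. K \<le> dist (fst v) (snd v)})"
    proof (rule finite_measure_mono)
      show "{v::'a \<times> 'a. 2 * r + K < norm v} \<subseteq> {v. r < norm (fst v)} \<union> {v. K \<le> dist (fst v) (snd v)}"
      proof (rule subsetI, rule ccontr)
        fix v :: "'a \<times> 'a"
        assume v: "v \<in> {v. 2 * r + K < norm v}" "v \<notin> {v. r < norm (fst v)} \<union> {v. K \<le> dist (fst v) (snd v)}"
        have "norm v \<le> norm (fst v) + norm (snd v)" using norm_Pair_le[of "fst v" "snd v"] by simp
        moreover have "norm (snd v) \<le> norm (fst v) + dist (fst v) (snd v)"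
          by (metis add.commute dist_commute dist_norm norm_triangle_sub)
        ultimately show False using v by auto
      qed
    qed (use S1 S2 in auto)
    also have "\<dots> \<le> measure (\<pi> n) {v. r < norm (fst v)} + measure (\<pi> n) {v. K \<le> dist (fst v) (snd v)}"
      by (rule measure_Un_le[OF S1 S2])
    also have "measure (\<pi> n) {v. r < norm (fst v)} = measure \<mu> {x. r < norm x}"
      using measure_distr[OF p(5), of "{x. r < norm x}" n] by (simp add: p(3) sp vimage_def)
    also have "measure (\<pi> n) {v. K \<le> dist (fst v) (snd v)} \<le> B / K\<^sup>2"
    proof -
      have "ennreal (K\<^sup>2) * emeasure (\<pi> n) {v. K \<le> dist (fst v) (snd v)}
          = (\<integral>\<^sup>+v. ennreal (K\<^sup>2) * indicator {v. K \<le> dist (fst v) (snd v)} v \<partial>\<pi> n)"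
        by (rule nn_integral_cmult_indicator[symmetric, OF S2])
      also have "\<dots> \<le> tcost (\<pi> n)"
        unfolding tcost_def using K(1)
        by (intro nn_integral_mono) (auto simp: indicator_def intro!: ennreal_leI power_mono)
      also have "\<dots> \<le> ennreal B" by (rule B)
      finally have "ennreal (K\<^sup>2 * measure (\<pi> n) {v. K \<le> dist (fst v) (snd v)}) \<le> ennreal B"
        by (simp add: emeasure_eq_measure ennreal_mult)
      then have "K\<^sup>2 * measure (\<pi> n) {v. K \<le> dist (fst v) (snd v)} \<le> B"
        using B(2) by (simp add: ennreal_le_iff)
      then show ?thesis using K(1) by (simp add: field_simps)
    qed
    finally show ?thesis using r(2) K(2) by linarith
  qed
  then show ?thesis by blast
qed

text \<open>The second marginals may vary; since projections are continuous, they converge narrowly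
  to the second marginal of the limit plan. This is how limits of measures are produced from bounds
  on distances.\<close>

lemma couplings_compact:
  fixes \<pi> :: "nat \<Rightarrow> ('a::euclidean_space \<times> 'a) measure"
  assumes \<pi>: "\<And>n. \<pi> n \<in> couplings \<mu> (\<nu> n)" and B: "\<And>n. tcost (\<pi> n) \<le> ennreal B" "0 \<le> B"
  obtains r \<rho> where "strict_mono r" "\<rho> \<in> couplings \<mu> (distr \<rho> borel snd)" "tcost \<rho> \<le> ennreal B"
    "narrowly_converges (\<nu> \<circ> r) (distr \<rho> borel snd)"
proof -
  note p = couplingsD[OF \<pi>]
  obtain r \<rho> where r: "strict_mono r" and \<rho>: "prob_space \<rho>" "sets \<rho> = sets borel"
    and conv: "narrowly_converges (\<pi> \<circ> r) \<rho>"
    using prokhorov[of \<pi>, OF p(1) p(2) couplings_tight[OF \<pi> B]] by blast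
  interpret prob_space \<rho> by (rule \<rho>)
  have m: "fst \<in> borel_measurable \<rho>" "snd \<in> borel_measurable \<rho>"
    by (simp_all add: measurable_cong_sets[OF \<rho>(2) refl])
  have s: "sets ((\<pi> \<circ> r) n) = sets borel" for n by (simp add: p)
  have "narrowly_converges (\<lambda>n. distr ((\<pi> \<circ> r) n) borel fst) (distr \<rho> borel fst)"
    by (rule narrowly_converges_distr[OF conv _ s \<rho>(2)]) (intro continuous_intros)
  moreover have "narrowly_converges (\<lambda>n. distr ((\<pi> \<circ> r) n) borel fst) \<mu>"
    by (simp add: p(3) narrowly_converges_def)
  ultimately have "distr \<rho> borel fst = \<mu>"
    using prob_measD[OF couplings_prob_meas(1)[OF \<pi>]] prob_space_distr[OF m(1)]
    by (intro narrowly_converges_unique) auto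
  then have "\<rho> \<in> couplings \<mu> (distr \<rho> borel snd)"
    using \<rho> by (simp add: couplings_def)
  moreover have "narrowly_converges (\<nu> \<circ> r) (distr \<rho> borel snd)"
  proof -
    have "narrowly_converges (\<lambda>n. distr ((\<pi> \<circ> r) n) borel snd) (distr \<rho> borel snd)"
      by (rule narrowly_converges_distr[OF conv _ s \<rho>(2)]) (intro continuous_intros)
    then show ?thesis by (simp add: p(4) comp_def)
  qed
  moreover have "tcost \<rho> \<le> ennreal B"
  proof -
    \<comment> \<open>The cost is unbounded, so narrow convergence is applied to its truncations,
      and monotone convergence then lets \<open>k\<close> grow.\<close>
    define c where "c k v = min (real k) ((dist (fst v) (snd v))\<^sup>2)" for k and v :: "'a \<times> 'a"
    have c: "continuous_on UNIV (c k)" "\<bar>c k v\<bar> \<le> real k" "0 \<le> c k v" for k v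
      unfolding c_def by (auto intro!: continuous_intros)
    have cm: "c k \<in> borel_measurable borel" for k using c(1) by (rule borel_measurable_continuous_onI)
    have nn: "(\<integral>\<^sup>+v. ennreal (c k v) \<partial>M) = ennreal (integral\<^sup>L M (c k))"
      if "prob_space M" "sets M = sets borel" for M k
    proof -
      interpret M: prob_space M by fact
      have "integrable M (c k)"
        using cm c(2) by (intro M.integrable_const_bound[where B = "real k"]) (auto simp: measurable_cong_sets[OF that(2) refl])
      then show "(\<integral>\<^sup>+v. ennreal (c k v) \<partial>M) = ennreal (integral\<^sup>L M (c k))"
        using c(3) by (intro nn_integral_eq_integral) auto
    qed
    have le: "(\<integral>\<^sup>+v. ennreal (c k v) \<partial>\<rho>) \<le> ennreal B" for k
    proof -
      have "integral\<^sup>L ((\<pi> \<circ> r) n) (c k) \<le> B" for n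
      proof -
        have "ennreal (integral\<^sup>L ((\<pi> \<circ> r) n) (c k)) = (\<integral>\<^sup>+v. ennreal (c k v) \<partial>(\<pi> (r n)))"
          using nn[OF p(1) p(2)] by simp
        also have "\<dots> \<le> tcost (\<pi> (r n))"
          unfolding tcost_def by (intro nn_integral_mono ennreal_leI) (simp add: c_def)
        also have "\<dots> \<le> ennreal B" by (rule B)
        finally show ?thesis using B(2) by (simp add: ennreal_le_iff)
      qed
      moreover have "(\<lambda>n. integral\<^sup>L ((\<pi> \<circ> r) n) (c k)) \<longlonglongrightarrow> integral\<^sup>L \<rho> (c k)"
        using conv c(1,2) unfolding narrowly_converges_def by blast
      ultimately have "integral\<^sup>L \<rho> (c k) \<le> B" by (intro LIMSEQ_le_const2) auto
      then show ?thesis unfolding nn[OF \<rho>] by (rule ennreal_leI)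
    qed
    have "tcost \<rho> = (\<integral>\<^sup>+v. (SUP k. ennreal (c k v)) \<partial>\<rho>)"
      unfolding tcost_def
    proof (rule nn_integral_cong)
      fix v :: "'a \<times> 'a"
      obtain k :: nat where k: "(dist (fst v) (snd v))\<^sup>2 < real k" using reals_Archimedean2 by blast
      show "ennreal ((dist (fst v) (snd v))\<^sup>2) = (SUP k. ennreal (c k v))"
      proof (rule antisym)
        have "ennreal ((dist (fst v) (snd v))\<^sup>2) = ennreal (c k v)" using k by (simp add: c_def)
        also have "\<dots> \<le> (SUP k. ennreal (c k v))" by (rule SUP_upper) simp
        finally show "ennreal ((dist (fst v) (snd v))\<^sup>2) \<le> (SUP k. ennreal (c k v))" .
        show "(SUP k. ennreal (c k v)) \<le> ennreal ((dist (fst v) (snd v))\<^sup>2)"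
          by (rule SUP_least) (auto simp: c_def intro!: ennreal_leI)
      qed
    qed
    also have "\<dots> = (SUP k. \<integral>\<^sup>+v. ennreal (c k v) \<partial>\<rho>)"
    proof (rule nn_integral_monotone_convergence_SUP)
      show "incseq (\<lambda>k v. ennreal (c k v))"
        by (auto simp: incseq_def le_fun_def c_def intro!: ennreal_leI)
      show "(\<lambda>v. ennreal (c k v)) \<in> borel_measurable \<rho>" for k
        using cm[of k] by (simp add: measurable_cong_sets[OF \<rho>(2) refl])
    qed
    also have "\<dots> \<le> ennreal B" by (rule SUP_least) (rule le)
    finally show ?thesis .
  qed
  ultimately show thesis using that r by blast
qed

lemma P2D:
  assumes "\<mu> \<in> P2 \<omega>0"
  shows "\<mu> \<in> prob_meas" "W2sq \<mu> \<omega>0 < \<infinity>" "W2sq \<omega>0 \<mu> < \<infinity>"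
  using assms W2sq_commute[of \<omega>0 \<mu>] by (auto simp: P2_def)

lemma P2_W2sq_finite:
  assumes "\<mu> \<in> P2 \<omega>0" "\<nu> \<in> P2 \<omega>0"
  shows "W2sq \<mu> \<nu> < \<infinity>"
  by (rule W2_triangle(1)[OF P2D(2)[OF assms(1)] P2D(3)[OF assms(2)]])

lemma P2_I:
  assumes "\<mu> \<in> prob_meas" "\<nu> \<in> P2 \<omega>0" "W2sq \<mu> \<nu> < \<infinity>"
  shows "\<mu> \<in> P2 \<omega>0"
  using W2_triangle(1)[OF assms(3) P2D(2)[OF assms(2)]] assms(1) by (simp add: P2_def)

text \<open>The candidate \<nu> arises from couplings with the fixed marginal \<open>s N1\<close>.
  For any other late index \<open>i\<close>, compactness is used again with \<open>s i\<close>
  fixed, along indices taken from the first subsequence, so uniqueness of narrow limits identifies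
  the new second marginal with \<nu>.\<close>

lemma W2_complete:
  fixes s :: "nat \<Rightarrow> 'a::euclidean_space measure"
  assumes s: "\<And>k. s k \<in> P2 \<omega>0" and cauchy: "\<And>e. 0 < e \<Longrightarrow> \<exists>N. \<forall>i\<ge>N. \<forall>j\<ge>N. W2 (s i) (s j) < e"
  shows "\<exists>\<nu>\<in>P2 \<omega>0. (\<lambda>k. W2 (s k) \<nu>) \<longlonglongrightarrow> 0"
proof -
  have close: "\<exists>\<pi>. \<pi> \<in> couplings (s i) (s j) \<and> tcost \<pi> \<le> ennreal (e\<^sup>2)" if "W2 (s i) (s j) < e" for i j e
  proof -
    have "W2sq (s i) (s j) < ennreal (e\<^sup>2)"
      unfolding W2sq_eq_W2[OF P2_W2sq_finite[OF s s]]
      using that W2_nonneg[of "s i" "s j"] by (simp add: ennreal_less_iff power_strict_mono)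
    then obtain \<pi> C where "\<pi> \<in> couplings (s i) (s j)" "tcost \<pi> = ennreal C" "0 \<le> C" "C < e\<^sup>2"
      by (rule coupling_below)
    then show ?thesis by (intro exI[of _ \<pi>]) (auto intro!: ennreal_leI)
  qed
  obtain N1 where N1: "\<And>i j. N1 \<le> i \<Longrightarrow> N1 \<le> j \<Longrightarrow> W2 (s i) (s j) < 1" using cauchy[of 1] by auto
  have "\<forall>j. \<exists>\<pi>. \<pi> \<in> couplings (s N1) (s (N1 + j)) \<and> tcost \<pi> \<le> ennreal (1\<^sup>2)"
    by (intro allI close N1) auto
  then obtain \<pi>0 where \<pi>0: "\<And>j. \<pi>0 j \<in> couplings (s N1) (s (N1 + j))" "\<And>j. tcost (\<pi>0 j) \<le> ennreal (1\<^sup>2)"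
    by metis
  obtain r0 \<rho>0 where r0: "strict_mono r0" and \<rho>0: "\<rho>0 \<in> couplings (s N1) (distr \<rho>0 borel snd)"
    "tcost \<rho>0 \<le> ennreal (1\<^sup>2)"
    and conv0: "narrowly_converges ((\<lambda>j. s (N1 + j)) \<circ> r0) (distr \<rho>0 borel snd)"
    by (rule couplings_compact[OF \<pi>0]) auto
  define \<nu> where "\<nu> = distr \<rho>0 borel snd"
  have \<nu>: "\<nu> \<in> prob_meas" unfolding \<nu>_def by (rule couplings_prob_meas(2)[OF \<rho>0(1)])
  have lim: "W2sq (s i) \<nu> \<le> ennreal (e\<^sup>2)" if N: "\<And>i j. N \<le> i \<Longrightarrow> N \<le> j \<Longrightarrow> W2 (s i) (s j) < e" "N \<le> i"
    for e N i
  proof -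
    \<comment> \<open>Skips \<open>N\<close> terms; since a strictly increasing \<open>r0\<close>
      satisfies \<open>j \<le> r0 j\<close>, all indices \<open>t j\<close> are then at least
      \<open>N\<close>.\<close>
    define r1 where "r1 j = N + j" for j :: nat
    have r1: "strict_mono r1" by (simp add: r1_def strict_mono_def)
    define t where "t j = N1 + r0 (r1 j)" for j
    have "N \<le> t j" for j
      using seq_suble[OF r0, of "r1 j"] by (simp add: t_def r1_def)
    then have "\<forall>j. \<exists>\<pi>. \<pi> \<in> couplings (s i) (s (t j)) \<and> tcost \<pi> \<le> ennreal (e\<^sup>2)"
      using close N by blast
    then obtain \<pi> where \<pi>: "\<And>j. \<pi> j \<in> couplings (s i) (s (t j))" "\<And>j. tcost (\<pi> j) \<le> ennreal (e\<^sup>2)"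
      by metis
    obtain r \<rho> where r: "strict_mono r" and \<rho>: "\<rho> \<in> couplings (s i) (distr \<rho> borel snd)"
      "tcost \<rho> \<le> ennreal (e\<^sup>2)" and conv: "narrowly_converges ((\<lambda>j. s (t j)) \<circ> r) (distr \<rho> borel snd)"
      by (rule couplings_compact[OF \<pi>]) auto
    have "narrowly_converges ((\<lambda>j. s (t j)) \<circ> r) \<nu>"
      using narrowly_converges_subseq[OF narrowly_converges_subseq[OF conv0 r1] r]
      by (simp add: \<nu>_def t_def comp_def)
    with conv have "distr \<rho> borel snd = \<nu>"
      using prob_measD[OF \<nu>] prob_measD[OF couplings_prob_meas(2)[OF \<rho>(1)]]
      by (intro narrowly_converges_unique) auto
    then have "W2sq (s i) \<nu> \<le> tcost \<rho>" unfolding W2sq_def using \<rho>(1) by (auto intro: INF_lower)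
    with \<rho>(2) show ?thesis by simp
  qed
  have "W2sq (s N1) \<nu> < \<infinity>" using lim[of N1 1 N1] N1 by (auto intro: le_less_trans)
  then have \<nu>P: "\<nu> \<in> P2 \<omega>0" using P2_I[OF \<nu> s[of N1]] W2sq_commute[of \<nu> "s N1"] by simp
  have "(\<lambda>k. W2 (s k) \<nu>) \<longlonglongrightarrow> 0"
  proof (rule LIMSEQ_I)
    fix e :: real assume e: "0 < e"
    obtain N where N: "\<And>i j. N \<le> i \<Longrightarrow> N \<le> j \<Longrightarrow> W2 (s i) (s j) < e / 2" using cauchy[of "e/2"] e by auto
    have half: "W2 (s i) \<nu> \<le> e / 2" if "N \<le> i" for i
      using lim[OF N that] e by (subst W2_le_iff[OF P2_W2sq_finite[OF s \<nu>P]]) auto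
    show "\<exists>N. \<forall>n\<ge>N. norm (W2 (s n) \<nu> - 0) < e"
    proof (intro exI[of _ N] allI impI)
      fix n assume "N \<le> n"
      then show "norm (W2 (s n) \<nu> - 0) < e" using half[of n] e W2_nonneg[of "s n" \<nu>] by simp
    qed
  qed
  with \<nu>P show ?thesis by blast
qed

section \<open>Convexity along generalized geodesics\<close>

lemma dist_convex_combination_power2:
  fixes x y z :: "'a::real_inner"
  shows "(dist x ((1 - \<alpha>) *\<^sub>R y + \<alpha> *\<^sub>R z))\<^sup>2
    = (1 - \<alpha>) * (dist x y)\<^sup>2 + \<alpha> * (dist x z)\<^sup>2 - \<alpha> * (1 - \<alpha>) * (dist y z)\<^sup>2"
proof -
  define u v where "u = x - y" and "v = x - z"
  have e: "x - ((1 - \<alpha>) *\<^sub>R y + \<alpha> *\<^sub>R z) = (1 - \<alpha>) *\<^sub>R u + \<alpha> *\<^sub>R v" "y - z = v - u"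
    by (simp_all add: u_def v_def algebra_simps)
  show ?thesis
    unfolding dist_norm e u_def[symmetric] v_def[symmetric] power2_norm_eq_inner
    by (simp add: inner_add_left inner_add_right inner_diff_left inner_diff_right inner_commute[of v u]
        algebra_simps power2_eq_square)
qed

lemma transport_planD:
  fixes \<Omega> :: "('a::euclidean_space \<times> 'a \<times> 'a) measure"
  assumes "\<Omega> \<in> transport_plans \<omega> \<mu>0 \<mu>1"
  shows "prob_space \<Omega>" "fst \<in> borel_measurable \<Omega>" "(\<lambda>w. fst (snd w)) \<in> borel_measurable \<Omega>"
    "(\<lambda>w. snd (snd w)) \<in> borel_measurable \<Omega>"
    "distr \<Omega> borel fst = \<omega>" "distr \<Omega> borel (\<lambda>w. fst (snd w)) = \<mu>0" "distr \<Omega> borel (\<lambda>w. snd (snd w)) = \<mu>1"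
    "(\<integral>\<^sup>+w. ennreal ((dist (fst w) (fst (snd w)))\<^sup>2) \<partial>\<Omega>) = W2sq \<omega> \<mu>0"
    "(\<integral>\<^sup>+w. ennreal ((dist (fst w) (snd (snd w)))\<^sup>2) \<partial>\<Omega>) = W2sq \<omega> \<mu>1"
proof -
  have O: "prob_space \<Omega>" "sets \<Omega> = sets borel"
    and opt: "distr \<Omega> borel (\<lambda>w. (fst w, fst (snd w))) \<in> opt_couplings \<omega> \<mu>0"
      "distr \<Omega> borel (\<lambda>w. (fst w, snd (snd w))) \<in> opt_couplings \<omega> \<mu>1"
  proof -
    have e: "(\<lambda>(x, y, z). (x, y)) = (\<lambda>w::'a \<times> 'a \<times> 'a. (fst w, fst (snd w)))"
      "(\<lambda>(x, y, z). (x, z)) = (\<lambda>w::'a \<times> 'a \<times> 'a. (fst w, snd (snd w)))"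
      by (auto simp: fun_eq_iff)
    show "prob_space \<Omega>" "sets \<Omega> = sets borel"
      "distr \<Omega> borel (\<lambda>w. (fst w, fst (snd w))) \<in> opt_couplings \<omega> \<mu>0"
      "distr \<Omega> borel (\<lambda>w. (fst w, snd (snd w))) \<in> opt_couplings \<omega> \<mu>1"
      using assms unfolding transport_plans_def e by blast+
  qed
  show "prob_space \<Omega>" by (rule O)
  have f: "fst \<in> borel_measurable \<Omega>" "snd \<in> borel_measurable \<Omega>"
    by (simp_all add: measurable_cong_sets[OF O(2) refl])
  show m: "fst \<in> borel_measurable \<Omega>" "(\<lambda>w. fst (snd w)) \<in> borel_measurable \<Omega>"
    "(\<lambda>w. snd (snd w)) \<in> borel_measurable \<Omega>"
    using f measurable_compose[OF f(2) borel_measurable_fst_snd(1)]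
      measurable_compose[OF f(2) borel_measurable_fst_snd(2)] by auto
  note c0 = couplings_distr[OF O(1) m(1,2)] and c1 = couplings_distr[OF O(1) m(1,3)]
  have o0: "distr \<Omega> borel (\<lambda>w. (fst w, fst (snd w))) \<in> couplings \<omega> \<mu>0"
    and o1: "distr \<Omega> borel (\<lambda>w. (fst w, snd (snd w))) \<in> couplings \<omega> \<mu>1"
    using opt by (auto simp: opt_couplings_def)
  show "distr \<Omega> borel fst = \<omega>" "distr \<Omega> borel (\<lambda>w. fst (snd w)) = \<mu>0" "distr \<Omega> borel (\<lambda>w. snd (snd w)) = \<mu>1"
    using couplingsD(3,4)[OF o0] couplingsD(3,4)[OF o1] couplingsD(3,4)[OF c0(1)] couplingsD(3,4)[OF c1(1)]
    by simp_all
  show "(\<integral>\<^sup>+w. ennreal ((dist (fst w) (fst (snd w)))\<^sup>2) \<partial>\<Omega>) = W2sq \<omega> \<mu>0"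
    "(\<integral>\<^sup>+w. ennreal ((dist (fst w) (snd (snd w)))\<^sup>2) \<partial>\<Omega>) = W2sq \<omega> \<mu>1"
    using opt c0(2) c1(2) by (simp_all add: opt_couplings_def)
qed

text \<open>Integrate the Euclidean identity \<open>dist_convex_combination_power2\<close> against
  the plan. The costs from the base to both ends equal the squared distances because the plan is
  optimal there, while the base and the interpolated point form some coupling, which bounds the
  remaining distance from above.\<close>

lemma transport_plan_convexity:
  fixes \<Omega> :: "('a::euclidean_space \<times> 'a \<times> 'a) measure"
  assumes \<Omega>: "\<Omega> \<in> transport_plans \<omega> \<mu>0 \<mu>1"
    and P: "\<omega> \<in> P2 \<omega>0" "\<mu>0 \<in> P2 \<omega>0" "\<mu>1 \<in> P2 \<omega>0"
  obtains K where "W2_plan_sq \<Omega> = ennreal K" "(W2 \<mu>0 \<mu>1)\<^sup>2 \<le> K"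
    "\<And>\<alpha>. 0 \<le> \<alpha> \<Longrightarrow> \<alpha> \<le> 1 \<Longrightarrow> gen_geod \<Omega> \<alpha> \<in> P2 \<omega>0"
    "\<And>\<alpha>. 0 \<le> \<alpha> \<Longrightarrow> \<alpha> \<le> 1 \<Longrightarrow> (W2 \<omega> (gen_geod \<Omega> \<alpha>))\<^sup>2
      \<le> (1 - \<alpha>) * (W2 \<omega> \<mu>0)\<^sup>2 + \<alpha> * (W2 \<omega> \<mu>1)\<^sup>2 - \<alpha> * (1 - \<alpha>) * K"
proof -
  note p = transport_planD[OF \<Omega>]
  note [measurable] = p(2-4)
  interpret prob_space \<Omega> by (rule p)
  have W0: "W2sq \<omega> \<mu>0 = ennreal ((W2 \<omega> \<mu>0)\<^sup>2)" and W1: "W2sq \<omega> \<mu>1 = ennreal ((W2 \<omega> \<mu>1)\<^sup>2)"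
    using W2sq_eq_W2 P2_W2sq_finite P by blast+
  define c0 c1 c where "c0 w = ennreal ((dist (fst w) (fst (snd w)))\<^sup>2)"
    and "c1 w = ennreal ((dist (fst w) (snd (snd w)))\<^sup>2)"
    and "c w = ennreal ((dist (fst (snd w)) (snd (snd w)))\<^sup>2)" for w :: "'a \<times> 'a \<times> 'a"
  have cm[measurable]: "c0 \<in> borel_measurable \<Omega>" "c1 \<in> borel_measurable \<Omega>" "c \<in> borel_measurable \<Omega>"
    unfolding c0_def[abs_def] c1_def[abs_def] c_def[abs_def] by measurable
  have I0: "(\<integral>\<^sup>+w. c0 w \<partial>\<Omega>) = ennreal ((W2 \<omega> \<mu>0)\<^sup>2)" and I1: "(\<integral>\<^sup>+w. c1 w \<partial>\<Omega>) = ennreal ((W2 \<omega> \<mu>1)\<^sup>2)"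
    unfolding c0_def c1_def p(8,9) by (fact W0, fact W1)
  have Wc: "W2_plan_sq \<Omega> = (\<integral>\<^sup>+w. c w \<partial>\<Omega>)" by (simp add: W2_plan_sq_def c_def)
  have "W2_plan_sq \<Omega> \<le> (\<integral>\<^sup>+w. 2 * c0 w + 2 * c1 w \<partial>\<Omega>)"
    unfolding Wc
  proof (rule nn_integral_mono)
    fix w :: "'a \<times> 'a \<times> 'a"
    define a b where "a = dist (fst w) (fst (snd w))" and "b = dist (fst w) (snd (snd w))"
    have "(dist (fst (snd w)) (snd (snd w)))\<^sup>2 \<le> (a + b)\<^sup>2"
      using dist_triangle3[of "fst (snd w)" "snd (snd w)" "fst w"] by (intro power_mono) (auto simp: a_def b_def)
    also have "\<dots> \<le> 2 * a\<^sup>2 + 2 * b\<^sup>2" using power2_sum_le_weighted[of 1 a b] by simp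
    finally have "c w \<le> ennreal (2 * a\<^sup>2 + 2 * b\<^sup>2)" unfolding c_def by (rule ennreal_leI)
    also have "\<dots> = 2 * c0 w + 2 * c1 w"
      by (simp add: c0_def c1_def a_def b_def ennreal_mult')
    finally show "c w \<le> 2 * c0 w + 2 * c1 w" .
  qed
  also have "\<dots> = 2 * (\<integral>\<^sup>+w. c0 w \<partial>\<Omega>) + 2 * (\<integral>\<^sup>+w. c1 w \<partial>\<Omega>)"
    by (simp add: nn_integral_add nn_integral_cmult)
  also have "\<dots> < \<infinity>" unfolding I0 I1 by (simp add: ennreal_mult_less_top)
  finally have "W2_plan_sq \<Omega> < \<infinity>" .
  then obtain K where K: "W2_plan_sq \<Omega> = ennreal K" "0 \<le> K" by (cases "W2_plan_sq \<Omega>") auto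
  have "W2sq \<mu>0 \<mu>1 \<le> W2_plan_sq \<Omega>"
    using W2sq_le_nn_integral[OF p(1,3,4)] by (simp only: p(6,7) W2_plan_sq_def)
  then have K1: "(W2 \<mu>0 \<mu>1)\<^sup>2 \<le> K"
    unfolding K(1) W2sq_eq_W2[OF P2_W2sq_finite[OF P(2,3)]] using K(2) by (simp add: ennreal_le_iff)
  \<comment> \<open>Stated as a sum because subtraction in \<open>ennreal\<close> is truncated; the
    term with \<open>K\<close> changes sides once everything is known to be finite.\<close>
  have main: "W2sq \<omega> (gen_geod \<Omega> \<alpha>) + ennreal (\<alpha> * (1 - \<alpha>) * K)
      \<le> ennreal ((1 - \<alpha>) * (W2 \<omega> \<mu>0)\<^sup>2 + \<alpha> * (W2 \<omega> \<mu>1)\<^sup>2)" and gp: "gen_geod \<Omega> \<alpha> \<in> prob_meas"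
    if a: "0 \<le> \<alpha>" "\<alpha> \<le> 1" for \<alpha>
  proof -
    define g where "g w = (1 - \<alpha>) *\<^sub>R fst (snd w) + \<alpha> *\<^sub>R snd (snd w)" for w :: "'a \<times> 'a \<times> 'a"
    have gm[measurable]: "g \<in> borel_measurable \<Omega>" unfolding g_def[abs_def] by measurable
    have gg: "gen_geod \<Omega> \<alpha> = distr \<Omega> borel g"
      unfolding gen_geod_def g_def[abs_def] by (simp add: case_prod_unfold)
    show "gen_geod \<Omega> \<alpha> \<in> prob_meas" unfolding gg prob_meas_def using prob_space_distr[OF gm] by simp
    have "W2sq \<omega> (gen_geod \<Omega> \<alpha>) \<le> (\<integral>\<^sup>+w. ennreal ((dist (fst w) (g w))\<^sup>2) \<partial>\<Omega>)"
      using W2sq_le_nn_integral[OF p(1,2) gm] by (simp only: p(5) gg)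
    moreover have "ennreal (\<alpha> * (1 - \<alpha>) * K) = (\<integral>\<^sup>+w. ennreal (\<alpha> * (1 - \<alpha>)) * c w \<partial>\<Omega>)"
      using a K(2) by (simp add: nn_integral_cmult Wc[symmetric] K(1) ennreal_mult')
    ultimately have "W2sq \<omega> (gen_geod \<Omega> \<alpha>) + ennreal (\<alpha> * (1 - \<alpha>) * K)
        \<le> (\<integral>\<^sup>+w. ennreal ((dist (fst w) (g w))\<^sup>2) \<partial>\<Omega>) + (\<integral>\<^sup>+w. ennreal (\<alpha> * (1 - \<alpha>)) * c w \<partial>\<Omega>)"
      by (simp add: add_right_mono)
    also have "\<dots> = (\<integral>\<^sup>+w. ennreal ((dist (fst w) (g w))\<^sup>2) + ennreal (\<alpha> * (1 - \<alpha>)) * c w \<partial>\<Omega>)"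
      by (rule nn_integral_add[symmetric]) measurable
    also have "\<dots> = (\<integral>\<^sup>+w. ennreal (1 - \<alpha>) * c0 w + ennreal \<alpha> * c1 w \<partial>\<Omega>)"
    proof (rule nn_integral_cong)
      fix w :: "'a \<times> 'a \<times> 'a"
      have "ennreal ((dist (fst w) (g w))\<^sup>2) + ennreal (\<alpha> * (1 - \<alpha>)) * c w
        = ennreal ((dist (fst w) (g w))\<^sup>2 + \<alpha> * (1 - \<alpha>) * (dist (fst (snd w)) (snd (snd w)))\<^sup>2)"
        unfolding c_def using a by (subst ennreal_plus) (auto simp: ennreal_mult')
      also have "(dist (fst w) (g w))\<^sup>2 + \<alpha> * (1 - \<alpha>) * (dist (fst (snd w)) (snd (snd w)))\<^sup>2
        = (1 - \<alpha>) * (dist (fst w) (fst (snd w)))\<^sup>2 + \<alpha> * (dist (fst w) (snd (snd w)))\<^sup>2"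
        unfolding g_def dist_convex_combination_power2 by simp
      also have "ennreal \<dots> = ennreal (1 - \<alpha>) * c0 w + ennreal \<alpha> * c1 w"
        unfolding c0_def c1_def using a by (subst ennreal_plus) (auto simp: ennreal_mult')
      finally show "ennreal ((dist (fst w) (g w))\<^sup>2) + ennreal (\<alpha> * (1 - \<alpha>)) * c w
        = ennreal (1 - \<alpha>) * c0 w + ennreal \<alpha> * c1 w" .
    qed
    also have "\<dots> = ennreal (1 - \<alpha>) * (\<integral>\<^sup>+w. c0 w \<partial>\<Omega>) + ennreal \<alpha> * (\<integral>\<^sup>+w. c1 w \<partial>\<Omega>)"
      by (simp add: nn_integral_add nn_integral_cmult)
    also have "\<dots> = ennreal ((1 - \<alpha>) * (W2 \<omega> \<mu>0)\<^sup>2 + \<alpha> * (W2 \<omega> \<mu>1)\<^sup>2)"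
      unfolding I0 I1 using a by (subst ennreal_plus) (auto simp: ennreal_mult')
    finally show "W2sq \<omega> (gen_geod \<Omega> \<alpha>) + ennreal (\<alpha> * (1 - \<alpha>) * K)
      \<le> ennreal ((1 - \<alpha>) * (W2 \<omega> \<mu>0)\<^sup>2 + \<alpha> * (W2 \<omega> \<mu>1)\<^sup>2)" .
  qed
  have fin: "W2sq \<omega> (gen_geod \<Omega> \<alpha>) < \<infinity>" if a: "0 \<le> \<alpha>" "\<alpha> \<le> 1" for \<alpha>
    using order.strict_trans1[OF main[OF a] ennreal_less_top] by simp
  show thesis
  proof (rule that[OF K(1) K1])
    fix \<alpha> :: real assume a: "0 \<le> \<alpha>" "\<alpha> \<le> 1"
    show "gen_geod \<Omega> \<alpha> \<in> P2 \<omega>0"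
      using P2_I[OF gp[OF a] P(1)] fin[OF a] W2sq_commute[of \<omega> "gen_geod \<Omega> \<alpha>"] by simp
    have "ennreal ((W2 \<omega> (gen_geod \<Omega> \<alpha>))\<^sup>2 + \<alpha> * (1 - \<alpha>) * K)
      \<le> ennreal ((1 - \<alpha>) * (W2 \<omega> \<mu>0)\<^sup>2 + \<alpha> * (W2 \<omega> \<mu>1)\<^sup>2)"
      using main[OF a] a K(2) unfolding W2sq_eq_W2[OF fin[OF a]] by (subst ennreal_plus) auto
    then have "(W2 \<omega> (gen_geod \<Omega> \<alpha>))\<^sup>2 + \<alpha> * (1 - \<alpha>) * K \<le> (1 - \<alpha>) * (W2 \<omega> \<mu>0)\<^sup>2 + \<alpha> * (W2 \<omega> \<mu>1)\<^sup>2"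
      using a by (subst (asm) ennreal_le_iff) auto
    then show "(W2 \<omega> (gen_geod \<Omega> \<alpha>))\<^sup>2
      \<le> (1 - \<alpha>) * (W2 \<omega> \<mu>0)\<^sup>2 + \<alpha> * (W2 \<omega> \<mu>1)\<^sup>2 - \<alpha> * (1 - \<alpha>) * K" by simp
  qed
qed

section \<open>Transfer to the Wasserstein space\<close>

lemma gg_convex_space_P2:
  fixes \<omega>0 :: "'a::euclidean_space measure"
  assumes E: "\<forall>\<nu>\<in>P2 \<omega>0. E \<nu> \<noteq> -\<infinity>" and coercive: "coercive_on \<omega>0 E" and lsc: "lsc_on \<omega>0 E"
    and convex: "gg_convex \<omega>0 lam E"
  shows "gg_convex_space (P2 \<omega>0) W2 E (max 0 (- lam))"
proof
  fix w x y :: "'a measure" assume P: "w \<in> P2 \<omega>0" "x \<in> P2 \<omega>0" "y \<in> P2 \<omega>0"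
  let ?l = "max 0 (- lam)"
  obtain \<Omega> where \<Omega>: "\<Omega> \<in> transport_plans w x y"
    and conv: "\<And>\<alpha>. \<alpha> \<in> {0..1} \<Longrightarrow> E (gen_geod \<Omega> \<alpha>) \<le> ereal (1 - \<alpha>) * E x + ereal \<alpha> * E y
          - ereal (\<alpha> * (1 - \<alpha>) * lam / 2) * enn2ereal (W2_plan_sq \<Omega>)"
    using convex P unfolding gg_convex_def by blast
  obtain K where K: "W2_plan_sq \<Omega> = ennreal K" "(W2 x y)\<^sup>2 \<le> K"
    "\<And>\<alpha>. 0 \<le> \<alpha> \<Longrightarrow> \<alpha> \<le> 1 \<Longrightarrow> gen_geod \<Omega> \<alpha> \<in> P2 \<omega>0"
    "\<And>\<alpha>. 0 \<le> \<alpha> \<Longrightarrow> \<alpha> \<le> 1 \<Longrightarrow> (W2 w (gen_geod \<Omega> \<alpha>))\<^sup>2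
      \<le> (1 - \<alpha>) * (W2 w x)\<^sup>2 + \<alpha> * (W2 w y)\<^sup>2 - \<alpha> * (1 - \<alpha>) * K"
    by (rule transport_plan_convexity[OF \<Omega> P]) (rule that)
  have K0: "0 \<le> K" using K(2) order_trans zero_le_power2 by blast
  have "E (gen_geod \<Omega> \<alpha>) \<le> ereal (1 - \<alpha>) * E x + ereal \<alpha> * E y + ereal (\<alpha> * (1 - \<alpha>) * ?l / 2 * K)"
    if a: "\<alpha> \<in> {0..1}" for \<alpha>
  proof -
    have "E (gen_geod \<Omega> \<alpha>) \<le> (ereal (1 - \<alpha>) * E x + ereal \<alpha> * E y) + ereal (- (\<alpha> * (1 - \<alpha>) * lam / 2 * K))"
      using conv[OF a] K0 by (simp add: K(1) minus_ereal_def)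
    also have "\<dots> \<le> (ereal (1 - \<alpha>) * E x + ereal \<alpha> * E y) + ereal (\<alpha> * (1 - \<alpha>) * ?l / 2 * K)"
    proof (rule add_left_mono)
      \<comment> \<open>As \<open>K\<close> is nonnegative, passing from \<open>- lam\<close> to its
        positive part only weakens the bound; a positive \<open>lam\<close> is treated like
        0.\<close>
      have "(\<alpha> * (1 - \<alpha>) / 2 * K) * (- lam) \<le> (\<alpha> * (1 - \<alpha>) / 2 * K) * ?l"
        using a K0 by (intro mult_left_mono mult_nonneg_nonneg) auto
      then show "ereal (- (\<alpha> * (1 - \<alpha>) * lam / 2 * K)) \<le> ereal (\<alpha> * (1 - \<alpha>) * ?l / 2 * K)"
        by (simp add: mult_ac)
    qed
    finally show ?thesis .
  qed
  with K show "\<exists>\<gamma> K. (W2 x y)\<^sup>2 \<le> K \<and> (\<forall>\<alpha>\<in>{0..1}. \<gamma> \<alpha> \<in> P2 \<omega>0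
        \<and> (W2 w (\<gamma> \<alpha>))\<^sup>2 \<le> (1 - \<alpha>) * (W2 w x)\<^sup>2 + \<alpha> * (W2 w y)\<^sup>2 - \<alpha> * (1 - \<alpha>) * K
        \<and> E (\<gamma> \<alpha>) \<le> ereal (1 - \<alpha>) * E x + ereal \<alpha> * E y + ereal (\<alpha> * (1 - \<alpha>) * ?l / 2 * K))"
    by (intro exI[of _ "gen_geod \<Omega>"] exI[of _ K]) simp
next
  obtain T u where T: "T > 0" "u \<in> P2 \<omega>0"
    and inf: "(INF v\<in>P2 \<omega>0. ereal ((W2 u v)\<^sup>2 / (2*T)) + E v) > -\<infinity>"
    using coercive unfolding coercive_on_def by blast
  obtain A :: real where A: "ereal A \<le> (INF v\<in>P2 \<omega>0. ereal ((W2 u v)\<^sup>2 / (2*T)) + E v)"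
    using inf by (cases "INF v\<in>P2 \<omega>0. ereal ((W2 u v)\<^sup>2 / (2*T)) + E v") auto
  have "ereal A \<le> ereal ((W2 u v)\<^sup>2 / (2*T)) + E v" if "v \<in> P2 \<omega>0" for v
    using order_trans[OF A INF_lower[OF that]] .
  then show "\<exists>T>0. \<exists>u\<in>P2 \<omega>0. \<exists>A::real. \<forall>v\<in>P2 \<omega>0. ereal A \<le> ereal ((W2 u v)\<^sup>2 / (2*T)) + E v"
    using T by blast
next
  fix x y z :: "'a measure" assume "x \<in> P2 \<omega>0" and y: "y \<in> P2 \<omega>0" and "z \<in> P2 \<omega>0"
  then show "W2 x z \<le> W2 x y + W2 y z"
    by (intro W2_triangle(2) P2_W2sq_finite[OF _ y] P2_W2sq_finite[OF y])
next
  fix x :: "'a measure" and s assume "x \<in> P2 \<omega>0" "\<And>k. s k \<in> P2 \<omega>0" "(\<lambda>k. W2 (s k) x) \<longlonglongrightarrow> 0"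
  then show "E x \<le> liminf (\<lambda>k. E (s k))" using lsc unfolding lsc_on_def by blast
next
  fix x :: "'a measure" assume "x \<in> P2 \<omega>0"
  from W2sq_refl[OF P2D(1)[OF this]] show "W2 x x = 0" by (simp add: W2_def)
next
  fix s :: "nat \<Rightarrow> 'a measure"
  assume "\<And>k. s k \<in> P2 \<omega>0" "\<And>e. 0 < e \<Longrightarrow> \<exists>N. \<forall>i\<ge>N. \<forall>j\<ge>N. W2 (s i) (s j) < e"
  then show "\<exists>x\<in>P2 \<omega>0. (\<lambda>k. W2 (s k) x) \<longlonglongrightarrow> 0" by (rule W2_complete)
qed (use E W2_nonneg W2_commute in auto)

theorem theorem2p6:
  fixes \<omega>0 \<mu> :: "'a::euclidean_space measure" and E :: "'a measure \<Rightarrow> ereal"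
    and lam \<tau> h :: real and n m :: nat
  assumes "\<omega>0 \<in> prob_meas"
    and "\<forall>\<nu>\<in>P2 \<omega>0. E \<nu> \<noteq> -\<infinity>"
    and "proper_on \<omega>0 E" and "coercive_on \<omega>0 E" and "lsc_on \<omega>0 E" and "gg_convex \<omega>0 lam E"
    and "\<mu> \<in> P2 \<omega>0" and "E \<mu> < \<infinity>" and "slope \<omega>0 E \<mu> < \<infinity>"
    and "0 < h" and "h \<le> \<tau>" and "max 0 (- lam) * \<tau> < 1"
  shows "W2sq ((JKO \<omega>0 E \<tau> ^^ n) \<mu>) ((JKO \<omega>0 E h ^^ m) \<mu>)
     \<le> ennreal (((real n * \<tau> - real m * h)^2 + \<tau> * h * real m + 2 * \<tau>^2 * real n)
          / ((1 - max 0 (- lam) * \<tau>) ^ (2*n) * (1 - max 0 (- lam) * h) ^ (2*m))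
          * (real_of_ereal (slope \<omega>0 E \<mu>))^2)"
proof -
  define l where "l = max 0 (- lam)"
  define S where "S = real_of_ereal (slope \<omega>0 E \<mu>)"
  interpret gg_convex_space "P2 \<omega>0" W2 E l
    unfolding l_def by (rule gg_convex_space_P2) fact+
  have \<mu>: "\<mu> \<in> dom_E" using assms by (simp add: dom_E_def)
  have t: "0 < \<tau>" "l * \<tau> < 1" using assms by (auto simp: l_def)
  have h: "0 < h" "l * h < 1" using assms mult_left_mono[OF assms(11) l_nonneg] t by auto
  \<comment> \<open>The predicate under \<open>SOME\<close> in \<open>JKO\<close> is
    \<open>is_step\<close>, so the chosen measure is a minimizer as soon as one exists.\<close>
  have JKO_step: "is_step s x (JKO \<omega>0 E s x)" if "x \<in> dom_E" "0 < s" "l * s < 1" for s x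
    using someI_ex[OF step_exists[OF that]] unfolding JKO_def is_step_def .
  have iter: "(JKO \<omega>0 E s ^^ k) \<mu> \<in> dom_E" if "0 < s" "l * s < 1" for s k
    by (induction k) (use \<mu> is_step_dom[OF _ JKO_step[OF _ that]] in auto)
  have step: "is_step s ((JKO \<omega>0 E s ^^ k) \<mu>) ((JKO \<omega>0 E s ^^ Suc k) \<mu>)" if "0 < s" "l * s < 1" for s k
    using JKO_step[OF iter[OF that] that] by simp
  \<comment> \<open>If a punctured ball around \<open>\<mu>\<close> is empty then the supremum over it is \<open>-\<infinity>\<close>; \<open>S\<close> is then 0.\<close>
  have S: "0 \<le> S" "slope \<omega>0 E \<mu> \<le> ereal S"
  proof -
    have "0 \<le> slope \<omega>0 E \<mu> \<or> slope \<omega>0 E \<mu> = -\<infinity>"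
    proof (cases "\<forall>r>0. \<exists>\<nu>\<in>P2 \<omega>0. 0 < W2 \<mu> \<nu> \<and> W2 \<mu> \<nu> < r")
      case True
      have "0 \<le> slope \<omega>0 E \<mu>"
        unfolding slope_def
      proof (rule INF_greatest)
        fix r :: real assume "r \<in> {0<..}"
        then obtain \<nu> where "\<nu> \<in> {\<nu>\<in>P2 \<omega>0. 0 < W2 \<mu> \<nu> \<and> W2 \<mu> \<nu> < r}" using True by auto
        then show "0 \<le> (SUP \<nu>\<in>{\<nu>\<in>P2 \<omega>0. 0 < W2 \<mu> \<nu> \<and> W2 \<mu> \<nu> < r}. max 0 ((E \<mu> - E \<nu>) / ereal (W2 \<mu> \<nu>)))"
          by (rule SUP_upper2) simp
      qed
      then show ?thesis ..
    next
      case False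
      then obtain r where r: "0 < r" "{\<nu>\<in>P2 \<omega>0. 0 < W2 \<mu> \<nu> \<and> W2 \<mu> \<nu> < r} = {}" by blast
      have "slope \<omega>0 E \<mu> \<le> (SUP \<nu>\<in>{\<nu>\<in>P2 \<omega>0. 0 < W2 \<mu> \<nu> \<and> W2 \<mu> \<nu> < r}. max 0 ((E \<mu> - E \<nu>) / ereal (W2 \<mu> \<nu>)))"
        unfolding slope_def by (rule INF_lower) (use r in simp)
      also have "\<dots> = -\<infinity>" unfolding r(2) by (simp add: bot_ereal_def)
      finally show ?thesis by simp
    qed
    then show "0 \<le> S" "slope \<omega>0 E \<mu> \<le> ereal S"
      using assms(9) unfolding S_def by (cases "slope \<omega>0 E \<mu>"; auto)+
  qed
  have "slope_bound \<mu> S"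
  proof (rule slope_boundI[OF \<mu> _ S(1)])
    fix \<epsilon> :: real assume "0 < \<epsilon>"
    then have "slope \<omega>0 E \<mu> < ereal (S + \<epsilon>)" using S(2) by (auto intro: le_less_trans)
    then obtain r where r: "0 < r"
      "(SUP \<nu>\<in>{\<nu>\<in>P2 \<omega>0. 0 < W2 \<mu> \<nu> \<and> W2 \<mu> \<nu> < r}. max 0 ((E \<mu> - E \<nu>) / ereal (W2 \<mu> \<nu>))) < ereal (S + \<epsilon>)"
      unfolding slope_def INF_less_iff by auto
    have "e \<mu> - e v \<le> (S + \<epsilon>) * W2 \<mu> v" if v: "v \<in> dom_E" "0 < W2 \<mu> v" "W2 \<mu> v < r" for v
    proof -
      have "max 0 ((E \<mu> - E v) / ereal (W2 \<mu> v))
        \<le> (SUP \<nu>\<in>{\<nu>\<in>P2 \<omega>0. 0 < W2 \<mu> \<nu> \<and> W2 \<mu> \<nu> < r}. max 0 ((E \<mu> - E \<nu>) / ereal (W2 \<mu> \<nu>)))"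
        using v dom_subset by (intro SUP_upper) auto
      also have "\<dots> \<le> ereal (S + \<epsilon>)" using r(2) by simp
      finally have "(E \<mu> - E v) / ereal (W2 \<mu> v) \<le> ereal (S + \<epsilon>)" by simp
      then have "(e \<mu> - e v) / W2 \<mu> v \<le> S + \<epsilon>" using v by (simp add: E_dom \<mu>)
      then show ?thesis using v by (simp add: field_simps)
    qed
    with r(1) show "\<exists>r>0. \<forall>v\<in>dom_E. 0 < W2 \<mu> v \<and> W2 \<mu> v < r \<longrightarrow> e \<mu> - e v \<le> (S + \<epsilon>) * W2 \<mu> v"
      by blast
  qed
  define P where "P = (1 - l * \<tau>) ^ (2*n) * (1 - l * h) ^ (2*m)"
  have P: "0 < P" unfolding P_def using t h by simp
  define x y where "x = (JKO \<omega>0 E \<tau> ^^ n) \<mu>" and "y = (JKO \<omega>0 E h ^^ m) \<mu>"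
  have "P * (W2 x y)\<^sup>2 \<le> kobayashi \<tau> h n m * S\<^sup>2"
    using two_scheme_estimate[of "\<lambda>n. (JKO \<omega>0 E \<tau> ^^ n) \<mu>" "\<lambda>m. (JKO \<omega>0 E h ^^ m) \<mu>", OF _ _ t h step[OF t] step[OF h]]
      \<mu> S \<open>slope_bound \<mu> S\<close> by (simp add: P_def x_def y_def)
  also have "\<dots> \<le> ((real n * \<tau> - real m * h)^2 + \<tau> * h * real m + 2 * \<tau>^2 * real n) * S\<^sup>2"
  proof (rule mult_right_mono)
    \<comment> \<open>Here \<open>h \<le> \<tau>\<close> turns the symmetric bound into the stated
      one.\<close>
    have "real m * (h * h) \<le> real m * (\<tau> * h)" "0 \<le> real n * \<tau>\<^sup>2"
      using assms(11) h t by (auto intro!: mult_left_mono mult_right_mono)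
    then show "kobayashi \<tau> h n m \<le> (real n * \<tau> - real m * h)^2 + \<tau> * h * real m + 2 * \<tau>^2 * real n"
      by (simp add: kobayashi_def power2_eq_square mult_ac)
  qed simp
  finally have "(W2 x y)\<^sup>2 \<le> ((real n * \<tau> - real m * h)^2 + \<tau> * h * real m + 2 * \<tau>^2 * real n) / P * S\<^sup>2"
    using P by (simp add: field_simps)
  moreover have "W2sq x y = ennreal ((W2 x y)\<^sup>2)"
    unfolding x_def y_def using iter[OF t] iter[OF h] dom_subset by (intro W2sq_eq_W2 P2_W2sq_finite) auto
  ultimately show ?thesis
    unfolding x_def[symmetric] y_def[symmetric] S_def[symmetric] l_def[symmetric] P_def[symmetric]
    by (simp add: ennreal_leI)
qed

end
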